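(* Let $P$ be a $d$-dimensional reflexive Fano polytope with ambient lattice $N$, let $M$ be the lattice dual to $N$, let $\overline M\subset M$ be the sublattice spanned by the vertices of $P^\vee$, and let $Q$ be the primitive dual of $P$. Fix a lattice $M_1$ with $\overline M\subset M_1\subset M$, and let $N_1=M_1^\vee$ be the lattice dual to $M_1$, so that $N\subset N_1\subset\overline N:=\overline M^\vee$. Then $$X_P/(N_1/N)\quad\text{and}\quad X_Q/(M_1/\overline M)$$ are a Batyrev--Borisov mirror pair.
   Context: For a lattice polytope $R$ in a lattice $L$ containing $0$ in its interior, $X_R$ is the toric variety of its spanning fan (cones over faces of $R$), and $R^\vee=\{v\in L^\vee_{\mathbb R}:\langle v,w\rangle\ge-1\ \forall w\in R\}$; $R$ is reflexive if $R^\vee$ is a lattice polytope. $P^\vee$ is the polytope of the anticanonical divisor of $X_P$. The primitive dual $Q$ of $P$ is the polytope $P^\vee$ regarded as a lattice polytope in $\overline M$ (its preimage under $\overline M\subset M$). For a finite-index inclusion of lattices $L\subset L_1$ and a polytope $R$ in $L$, the finite group $L_1/L$ acts on $X_R$, and $X_R/(L_1/L)$ is the toric variety of the spanning fan of $R$ viewed in $L_1$. Two toric varieties form a Batyrev--Borisov mirror pair if they are $X_R$ and $X_{R^\vee}$ for a dual pair of reflexive polytopes $R,R^\vee$. *)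

theory Defs
  imports "HOL-Analysis.Analysis"
begin

section \<open>Lattices and lattice polytopes\<close>

text \<open>
  All lattices of rank \<open>d\<close> live in one \<open>d\<close>-dimensional Euclidean space, whose inner product plays the
  role of the pairing between \<open>N\<^sub>\<real>\<close> and \<open>M\<^sub>\<real>\<close>. A lattice polytope is a pair of a lattice and a subset
  of the ambient space, so regarding a polytope in another lattice only changes the first component.
\<close>

definition int_span :: "'a::real_vector set \<Rightarrow> 'a set" where
  "int_span S = {\<Sum>v\<in>T. of_int (c v) *\<^sub>R v | T c. finite T \<and> T \<subseteq> S}"

definition full_lattice :: "'a::euclidean_space set \<Rightarrow> bool" where
  "full_lattice L \<longleftrightarrow> (\<exists>B. independent B \<and> span B = UNIV \<and> L = int_span B)"

definition dual_lattice :: "'a::euclidean_space set \<Rightarrow> 'a set" where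
  "dual_lattice L = {m. \<forall>n\<in>L. m \<bullet> n \<in> \<int>}"

lemma dual_lattice_antimono: "L \<subseteq> L' \<Longrightarrow> dual_lattice L' \<subseteq> dual_lattice L"
  unfolding dual_lattice_def by blast

lemma subset_dual_dual_lattice: "L \<subseteq> dual_lattice (dual_lattice L)"
  unfolding dual_lattice_def by (auto simp: inner_commute)

definition vertices :: "'a::euclidean_space set \<Rightarrow> 'a set" where
  "vertices R = {v. v extreme_point_of R}"

definition lattice_polytope :: "'a::euclidean_space set \<Rightarrow> 'a set \<Rightarrow> bool" where
  "lattice_polytope L R \<longleftrightarrow> polytope R \<and> vertices R \<subseteq> L"

definition primitive_vector :: "'a::euclidean_space set \<Rightarrow> 'a \<Rightarrow> bool" where
  "primitive_vector L v \<longleftrightarrow>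
     v \<in> L \<and> v \<noteq> 0 \<and> (\<forall>w\<in>L. \<forall>k::int. v = of_int k *\<^sub>R w \<longrightarrow> \<bar>k\<bar> = 1)"

definition fano_polytope :: "'a::euclidean_space set \<Rightarrow> 'a set \<Rightarrow> bool" where
  "fano_polytope L R \<longleftrightarrow>
     lattice_polytope L R \<and> 0 \<in> interior R \<and> (\<forall>v\<in>vertices R. primitive_vector L v)"

definition polar_dual :: "'a::euclidean_space set \<Rightarrow> 'a set" where
  "polar_dual R = {v. \<forall>w\<in>R. v \<bullet> w \<ge> -1}"

definition reflexive_polytope :: "'a::euclidean_space set \<Rightarrow> 'a set \<Rightarrow> bool" where
  "reflexive_polytope L R \<longleftrightarrow>
     lattice_polytope L R \<and> 0 \<in> interior R \<and> lattice_polytope (dual_lattice L) (polar_dual R)"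

text \<open>The face \<open>{}\<close> contributes the cone \<open>{0}\<close>.\<close>

definition spanning_fan :: "'a::euclidean_space set \<Rightarrow> 'a set set" where
  "spanning_fan R = {convex_cone hull F | F. F face_of R \<and> F \<noteq> R}"


section \<open>Spaces with functions\<close>

text \<open>
  Complex varieties are given by their closed points, the Zariski topology on them, and the sheaf of
  regular complex-valued functions. Functions on an open set \<open>V\<close> are represented by total functions
  of which only the values on \<open>V\<close> matter.
\<close>

record 'p fun_space =
  zariski :: "'p topology"
  regular :: "'p set \<Rightarrow> ('p \<Rightarrow> complex) set"

abbreviation points :: "('p, 'z) fun_space_scheme \<Rightarrow> 'p set" where
  "points X \<equiv> topspace (zariski X)"

definition fun_space_iso :: "('p, 'y) fun_space_scheme \<Rightarrow> ('q, 'z) fun_space_scheme \<Rightarrow> bool" where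
  "fun_space_iso X Y \<longleftrightarrow>
     (\<exists>\<phi>. homeomorphic_map (zariski X) (zariski Y) \<phi> \<and>
        (\<forall>V f. openin (zariski Y) V \<longrightarrow>
           (f \<in> regular Y V \<longleftrightarrow> f \<circ> \<phi> \<in> regular X {p \<in> points X. \<phi> p \<in> V})))"

text \<open>
  The quotient by a group \<open>G\<close> of automorphisms: the orbit space, with the quotient topology and the
  invariant regular functions.
\<close>

definition orbit_of :: "('p \<Rightarrow> 'p) set \<Rightarrow> 'p \<Rightarrow> 'p set" where
  "orbit_of G p = {g p | g. g \<in> G}"

definition quotient_space :: "('p, 'z) fun_space_scheme \<Rightarrow> ('p \<Rightarrow> 'p) set \<Rightarrow> 'p set fun_space" where
  "quotient_space X G =
     \<lparr>zariski = topology (\<lambda>V. V \<subseteq> orbit_of G ` points X \<and>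
                            openin (zariski X) {p \<in> points X. orbit_of G p \<in> V}),
      regular = (\<lambda>V. {f. f \<circ> orbit_of G \<in> regular X {p \<in> points X. orbit_of G p \<in> V}})\<rparr>"

lemma openin_final:
  assumes "\<And>i. i \<in> I \<Longrightarrow> topspace (T i) = U i" "\<And>i. i \<in> I \<Longrightarrow> \<pi> i ` U i \<subseteq> Z"
  shows "openin (topology (\<lambda>V. V \<subseteq> Z \<and> (\<forall>i\<in>I. openin (T i) {p \<in> U i. \<pi> i p \<in> V}))) V \<longleftrightarrow>
           V \<subseteq> Z \<and> (\<forall>i\<in>I. openin (T i) {p \<in> U i. \<pi> i p \<in> V})"
proof -
  have "istopology (\<lambda>V. V \<subseteq> Z \<and> (\<forall>i\<in>I. openin (T i) {p \<in> U i. \<pi> i p \<in> V}))"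
    unfolding istopology_def
  proof (intro conjI allI impI ballI)
    fix A B i
    assume A: "A \<subseteq> Z \<and> (\<forall>i\<in>I. openin (T i) {p \<in> U i. \<pi> i p \<in> A})"
      and B: "B \<subseteq> Z \<and> (\<forall>i\<in>I. openin (T i) {p \<in> U i. \<pi> i p \<in> B})" and i: "i \<in> I"
    have "{p \<in> U i. \<pi> i p \<in> A \<inter> B} = {p \<in> U i. \<pi> i p \<in> A} \<inter> {p \<in> U i. \<pi> i p \<in> B}" by blast
    then show "openin (T i) {p \<in> U i. \<pi> i p \<in> A \<inter> B}" using A B i by auto
  next
    fix K i
    assume K: "\<forall>A\<in>K. A \<subseteq> Z \<and> (\<forall>i\<in>I. openin (T i) {p \<in> U i. \<pi> i p \<in> A})" and i: "i \<in> I"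
    have "{p \<in> U i. \<pi> i p \<in> \<Union>K} = (\<Union>A\<in>K. {p \<in> U i. \<pi> i p \<in> A})" by blast
    then show "openin (T i) {p \<in> U i. \<pi> i p \<in> \<Union>K}" using K i by auto
  qed blast+
  then show ?thesis by (simp add: topology_inverse')
qed

lemma openin_quotient_space:
  "openin (zariski (quotient_space X G)) V \<longleftrightarrow>
     V \<subseteq> orbit_of G ` points X \<and> openin (zariski X) {p \<in> points X. orbit_of G p \<in> V}"
  using openin_final[of "{()}" "\<lambda>_. zariski X" "\<lambda>_. points X" "\<lambda>_. orbit_of G"
      "orbit_of G ` points X" V]
  by (simp add: quotient_space_def)


section \<open>Toric varieties\<close>

definition dual_cone :: "'a::euclidean_space set \<Rightarrow> 'a set" where
  "dual_cone \<sigma> = {m. \<forall>v\<in>\<sigma>. m \<bullet> v \<ge> 0}"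

definition cone_monoid :: "'a::euclidean_space set \<Rightarrow> 'a set \<Rightarrow> 'a set" where
  "cone_monoid L \<sigma> = dual_cone \<sigma> \<inter> dual_lattice L"

text \<open>
  The closed points of \<open>U\<^sub>\<sigma> = Spec \<complex>[S\<^sub>\<sigma>]\<close> are the monoid homomorphisms from \<open>S\<^sub>\<sigma>\<close> to the multiplicative
  monoid of the complex numbers. The coordinate ring consists of the linear combinations of the
  characters \<open>x \<mapsto> x m\<close>.
\<close>

definition affine_chart :: "'a::euclidean_space set \<Rightarrow> 'a set \<Rightarrow> ('a \<Rightarrow> complex) set" where
  "affine_chart L \<sigma> =
     {x \<in> extensional (cone_monoid L \<sigma>). x 0 = 1 \<and>
        (\<forall>m\<in>cone_monoid L \<sigma>. \<forall>m'\<in>cone_monoid L \<sigma>. x (m + m') = x m * x m')}"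

definition coordinate_ring :: "'a::euclidean_space set \<Rightarrow> 'a set \<Rightarrow> (('a \<Rightarrow> complex) \<Rightarrow> complex) set" where
  "coordinate_ring L \<sigma> =
     {\<lambda>x. \<Sum>m\<in>A. c m * x m | A c. finite A \<and> A \<subseteq> cone_monoid L \<sigma>}"

definition chart_topology :: "'a::euclidean_space set \<Rightarrow> 'a set \<Rightarrow> ('a \<Rightarrow> complex) topology" where
  "chart_topology L \<sigma> =
     topology_generated_by {{x \<in> affine_chart L \<sigma>. a x \<noteq> 0} | a. a \<in> coordinate_ring L \<sigma>}"

text \<open>
  The toric variety of a fan \<open>\<Sigma>\<close> is glued from the charts \<open>U\<^sub>\<sigma>\<close> along the maps \<open>U\<^sub>\<tau> \<rightarrow> U\<^sub>\<sigma>\<close> that restrict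
  homomorphisms to \<open>S\<^sub>\<sigma> \<subseteq> S\<^sub>\<tau>\<close>, for \<open>\<tau>\<close> a face of \<open>\<sigma>\<close>. Its points are equivalence classes of
  pairs \<open>(\<sigma>, x)\<close> with \<open>x\<close> in \<open>U\<^sub>\<sigma>\<close>.
\<close>

type_synonym 'a toric_point = "('a set \<times> ('a \<Rightarrow> complex)) set"

definition glue :: "'a::euclidean_space set \<Rightarrow> 'a set set \<Rightarrow>
    'a set \<times> ('a \<Rightarrow> complex) \<Rightarrow> 'a set \<times> ('a \<Rightarrow> complex) \<Rightarrow> bool" where
  "glue L \<Sigma> p q \<longleftrightarrow>
     (\<exists>\<tau>\<in>\<Sigma>. \<exists>\<sigma>\<in>\<Sigma>. \<exists>y\<in>affine_chart L \<tau>.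
        \<tau> face_of \<sigma> \<and> p = (\<tau>, y) \<and> q = (\<sigma>, restrict y (cone_monoid L \<sigma>)))"

definition chart_map :: "'a::euclidean_space set \<Rightarrow> 'a set set \<Rightarrow> 'a set \<Rightarrow> ('a \<Rightarrow> complex) \<Rightarrow>
    'a toric_point" where
  "chart_map L \<Sigma> \<sigma> x = {q. equivclp (glue L \<Sigma>) (\<sigma>, x) q}"

definition toric_points :: "'a::euclidean_space set \<Rightarrow> 'a set set \<Rightarrow> 'a toric_point set" where
  "toric_points L \<Sigma> = (\<Union>\<sigma>\<in>\<Sigma>. chart_map L \<Sigma> \<sigma> ` affine_chart L \<sigma>)"

definition chart_preimage :: "'a::euclidean_space set \<Rightarrow> 'a set set \<Rightarrow> 'a set \<Rightarrow>
    'a toric_point set \<Rightarrow> ('a \<Rightarrow> complex) set" where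
  "chart_preimage L \<Sigma> \<sigma> V = {x \<in> affine_chart L \<sigma>. chart_map L \<Sigma> \<sigma> x \<in> V}"

definition toric_variety :: "'a::euclidean_space set \<Rightarrow> 'a set set \<Rightarrow> 'a toric_point fun_space" where
  "toric_variety L \<Sigma> =
     \<lparr>zariski = topology (\<lambda>V. V \<subseteq> toric_points L \<Sigma> \<and>
                  (\<forall>\<sigma>\<in>\<Sigma>. openin (chart_topology L \<sigma>) (chart_preimage L \<Sigma> \<sigma> V))),
      regular = (\<lambda>V. {f. \<forall>\<sigma>\<in>\<Sigma>. \<forall>x\<in>chart_preimage L \<Sigma> \<sigma> V.
                  \<exists>W. openin (chart_topology L \<sigma>) W \<and> x \<in> W \<and> W \<subseteq> chart_preimage L \<Sigma> \<sigma> V \<and>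
                    (\<exists>a\<in>coordinate_ring L \<sigma>. \<exists>b\<in>coordinate_ring L \<sigma>.
                       \<forall>z\<in>W. b z \<noteq> 0 \<and> f (chart_map L \<Sigma> \<sigma> z) = a z / b z)})\<rparr>"

abbreviation polytope_variety :: "'a::euclidean_space set \<Rightarrow> 'a set \<Rightarrow> 'a toric_point fun_space" where
  "polytope_variety L R \<equiv> toric_variety L (spanning_fan R)"

text \<open>
  For \<open>L \<subseteq> L\<^sub>1\<close> the group \<open>L\<^sub>1 / L\<close> is the kernel of the map of tori \<open>L \<otimes> \<complex>\<^sup>* \<rightarrow> L\<^sub>1 \<otimes> \<complex>\<^sup>*\<close>: the
  class of \<open>n\<close> multiplies the character of \<open>m\<close> by \<open>exp (2 \<pi> \<i> \<langle>m, n\<rangle>)\<close>.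
\<close>

definition chart_act :: "'a::euclidean_space set \<Rightarrow> 'a \<Rightarrow> 'a set \<times> ('a \<Rightarrow> complex) \<Rightarrow>
    'a set \<times> ('a \<Rightarrow> complex)" where
  "chart_act L n = (\<lambda>(\<sigma>, x). (\<sigma>, \<lambda>m\<in>cone_monoid L \<sigma>. cis (2 * pi * (m \<bullet> n)) * x m))"

definition torus_act :: "'a::euclidean_space set \<Rightarrow> 'a \<Rightarrow> 'a toric_point \<Rightarrow> 'a toric_point" where
  "torus_act L n C = chart_act L n ` C"

definition toric_quotient :: "'a::euclidean_space set \<Rightarrow> 'a set \<Rightarrow> 'a set \<Rightarrow>
    'a toric_point set fun_space" where
  "toric_quotient L R L\<^sub>1 = quotient_space (polytope_variety L R) (torus_act L ` L\<^sub>1)"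

lemma cone_monoid_add:
  "m \<in> cone_monoid L \<sigma> \<Longrightarrow> m' \<in> cone_monoid L \<sigma> \<Longrightarrow> m + m' \<in> cone_monoid L \<sigma>"
  by (auto simp: cone_monoid_def dual_cone_def dual_lattice_def inner_add_left)

lemma zero_in_cone_monoid: "0 \<in> cone_monoid L \<sigma>"
  by (simp add: cone_monoid_def dual_cone_def dual_lattice_def)

lemma cone_monoid_antimono: "\<tau> \<subseteq> \<sigma> \<Longrightarrow> cone_monoid L \<sigma> \<subseteq> cone_monoid L \<tau>"
  by (auto simp: cone_monoid_def dual_cone_def)

lemma restrict_affine_chart:
  assumes "y \<in> affine_chart L \<tau>" "\<tau> \<subseteq> \<sigma>"
  shows "restrict y (cone_monoid L \<sigma>) \<in> affine_chart L \<sigma>"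
  using assms cone_monoid_antimono[of \<tau> \<sigma> L]
  by (auto simp: affine_chart_def zero_in_cone_monoid cone_monoid_add subset_iff)

lemma topspace_chart_topology: "topspace (chart_topology L \<sigma>) = affine_chart L \<sigma>"
proof -
  have one: "(\<lambda>x. x 0) \<in> coordinate_ring L \<sigma>"
    unfolding coordinate_ring_def mem_Collect_eq
    by (rule exI[of _ "{0}"], rule exI[of _ "\<lambda>_. 1"]) (simp add: zero_in_cone_monoid)
  have "affine_chart L \<sigma> = {x \<in> affine_chart L \<sigma>. x 0 \<noteq> 0}"
    by (auto simp: affine_chart_def)
  with one have "affine_chart L \<sigma> \<in>
      {{x \<in> affine_chart L \<sigma>. a x \<noteq> 0} | a. a \<in> coordinate_ring L \<sigma>}"
    unfolding mem_Collect_eq by (intro exI[of _ "\<lambda>x. x 0"] conjI)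
  then show ?thesis
    unfolding chart_topology_def by (auto simp: topology_generated_by_topspace)
qed

lemma openin_toric_variety:
  "openin (zariski (toric_variety L \<Sigma>)) V \<longleftrightarrow>
     V \<subseteq> toric_points L \<Sigma> \<and>
     (\<forall>\<sigma>\<in>\<Sigma>. openin (chart_topology L \<sigma>) (chart_preimage L \<Sigma> \<sigma> V))"
  unfolding toric_variety_def fun_space.simps chart_preimage_def
  by (rule openin_final) (auto simp: topspace_chart_topology toric_points_def)

lemma points_toric_variety: "points (toric_variety L \<Sigma>) = toric_points L \<Sigma>"
proof -
  have "chart_preimage L \<Sigma> \<sigma> (toric_points L \<Sigma>) = topspace (chart_topology L \<sigma>)" if "\<sigma> \<in> \<Sigma>" for \<sigma>
    using that by (auto simp: chart_preimage_def topspace_chart_topology toric_points_def)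
  then have "openin (zariski (toric_variety L \<Sigma>)) (toric_points L \<Sigma>)"
    by (simp add: openin_toric_variety)
  then show ?thesis
    by (meson openin_toric_variety openin_subset openin_topspace subset_antisym)
qed

lemma chart_act_add: "chart_act L n (chart_act L n' p) = chart_act L (n + n') p"
  by (cases p) (auto simp: chart_act_def inner_add_right distrib_left fun_eq_iff simp flip: cis_mult)

lemma chart_act_trivial:
  assumes "n \<in> L" "x \<in> affine_chart L \<sigma>"
  shows "chart_act L n (\<sigma>, x) = (\<sigma>, x)"
proof -
  have "cis (2 * pi * (m \<bullet> n)) = 1" if "m \<in> cone_monoid L \<sigma>" for m
    using that assms(1) by (intro cis_multiple_2pi) (auto simp: cone_monoid_def dual_lattice_def)
  then show ?thesis
    using assms(2) by (auto simp: chart_act_def affine_chart_def extensional_def fun_eq_iff)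
qed

lemma chart_act_affine_chart:
  assumes "x \<in> affine_chart L \<sigma>"
  shows "snd (chart_act L n (\<sigma>, x)) \<in> affine_chart L \<sigma>"
  using assms
  by (auto simp: chart_act_def affine_chart_def zero_in_cone_monoid cone_monoid_add inner_add_left
      distrib_left simp flip: cis_mult)

lemma glue_chart_act:
  assumes "glue L \<Sigma> p q"
  shows "glue L \<Sigma> (chart_act L n p) (chart_act L n q)"
proof -
  from assms obtain \<tau> \<sigma> y where *: "\<tau> \<in> \<Sigma>" "\<sigma> \<in> \<Sigma>" "y \<in> affine_chart L \<tau>" "\<tau> face_of \<sigma>"
      "p = (\<tau>, y)" "q = (\<sigma>, restrict y (cone_monoid L \<sigma>))"
    unfolding glue_def by blast
  define z where "z = snd (chart_act L n (\<tau>, y))"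
  have "chart_act L n q = (\<sigma>, restrict z (cone_monoid L \<sigma>))"
    using cone_monoid_antimono[OF face_of_imp_subset[OF *(4)], of L]
    by (auto simp: * z_def chart_act_def fun_eq_iff restrict_def)
  moreover have "chart_act L n p = (\<tau>, z)" by (simp add: * z_def chart_act_def)
  moreover have "z \<in> affine_chart L \<tau>" unfolding z_def by (rule chart_act_affine_chart[OF *(3)])
  ultimately show ?thesis unfolding glue_def using *(1,2,4) by blast
qed

lemma equivclp_chart_act:
  assumes "equivclp (glue L \<Sigma>) p q"
  shows "equivclp (glue L \<Sigma>) (chart_act L n p) (chart_act L n q)"
  using assms
proof (induction rule: equivclp_induct)
  case base
  show ?case by simp
next
  case (step y z)
  then show ?case by (meson glue_chart_act equivclp_into_equivclp)
qed

lemma equivclp_glue_chart: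
  assumes "equivclp (glue L \<Sigma>) p q" "snd p \<in> affine_chart L (fst p)"
  shows "snd q \<in> affine_chart L (fst q)"
  using assms
  by (induction rule: equivclp_induct)
     (auto simp: glue_def intro: restrict_affine_chart[OF _ face_of_imp_subset])

lemma torus_act_chart_map:
  assumes "x \<in> affine_chart L \<sigma>" "0 \<in> L"
  shows "torus_act L n (chart_map L \<Sigma> \<sigma> x) = chart_map L \<Sigma> \<sigma> (snd (chart_act L n (\<sigma>, x)))"
proof -
  have e: "(\<sigma>, snd (chart_act L n (\<sigma>, x))) = chart_act L n (\<sigma>, x)" by (simp add: chart_act_def)
  have inv: "chart_act L n (chart_act L (- n) q) = q \<and> chart_act L (- n) (chart_act L n q) = q"
    if "snd q \<in> affine_chart L (fst q)" for q
    using chart_act_trivial[OF assms(2) that] by (simp add: chart_act_add)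
  show ?thesis
    unfolding torus_act_def chart_map_def e
  proof (intro subset_antisym subsetI)
    fix q assume "q \<in> {q. equivclp (glue L \<Sigma>) (chart_act L n (\<sigma>, x)) q}"
    then have q: "equivclp (glue L \<Sigma>) (chart_act L n (\<sigma>, x)) q" by simp
    have "snd q \<in> affine_chart L (fst q)"
      using equivclp_glue_chart[OF q] chart_act_affine_chart[OF assms(1), of n]
      by (simp add: chart_act_def)
    then have "q = chart_act L n (chart_act L (- n) q)" using inv by simp
    moreover have "equivclp (glue L \<Sigma>) (\<sigma>, x) (chart_act L (- n) q)"
      using equivclp_chart_act[OF q, of "- n"] inv[of "(\<sigma>, x)"] assms(1) by simp
    ultimately show "q \<in> chart_act L n ` {q. equivclp (glue L \<Sigma>) (\<sigma>, x) q}" by blast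
  qed (auto intro: equivclp_chart_act)
qed


section \<open>Mirror pairs\<close>

text \<open>
  The type argument is the ambient space of the reflexive polytopes. Equality with the toric
  varieties of the polytopes is understood up to isomorphism.
\<close>

definition batyrev_borisov_mirror_pair ::
    "'a::euclidean_space itself \<Rightarrow> ('p, 'y) fun_space_scheme \<Rightarrow> ('q, 'z) fun_space_scheme \<Rightarrow> bool" where
  "batyrev_borisov_mirror_pair _ X Y \<longleftrightarrow>
     (\<exists>(L :: 'a set) R. full_lattice L \<and>
        reflexive_polytope L R \<and> reflexive_polytope (dual_lattice L) (polar_dual R) \<and>
        fun_space_iso X (polytope_variety L R) \<and>
        fun_space_iso Y (polytope_variety (dual_lattice L) (polar_dual R)))"

end

theory Submission
  imports Defs
begin

text \<open>
  The mirror pair is realised by \<open>P\<close> in the lattice \<open>N\<^sub>1\<close> and its polar dual \<open>Q\<close> in \<open>M\<^sub>1\<close>. These are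
  reflexive because the vertices of \<open>P\<close> lie in \<open>N \<subseteq> N\<^sub>1\<close>, those of \<open>Q\<close> lie in \<open>Mbar \<subseteq> M\<^sub>1\<close>, the
  lattices \<open>N\<^sub>1\<close> and \<open>M\<^sub>1\<close> are dual to each other, and the polar dual of \<open>Q\<close> is \<open>P\<close>. What has to be
  proved is that passing to the overlattice \<open>L\<^sub>1\<close> of \<open>L\<close> divides the toric variety of a fan by
  \<open>L\<^sub>1 / L\<close> (\<open>quotient_iso_toric_variety\<close>); it is applied to \<open>N \<subseteq> N\<^sub>1\<close> and to \<open>Mbar \<subseteq> M\<^sub>1\<close>.

  On a chart, the monoid \<open>S\<^sub>1 = \<sigma>\<^sup>\<or> \<inter> L\<^sub>1\<^sup>*\<close> sits inside \<open>S = \<sigma>\<^sup>\<or> \<inter> L\<^sup>*\<close>, and the quotient map restricts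
  a homomorphism \<open>S \<rightarrow> \<complex>\<close> to \<open>S\<^sub>1\<close>. Every element of \<open>S\<close> has a positive multiple in \<open>S\<^sub>1\<close>, and the
  following facts make restriction a quotient map of spaces with functions.

  \<^item> It is surjective (\<open>extend_chart_point\<close>) and its fibres are the orbits (\<open>chart_fibre_is_orbit\<close>).
    Both hold because \<open>\<complex>\<^sup>*\<close> is divisible: a character of a subgroup of a lattice extends to the lattice,
    and thus has the form \<open>exp \<circ> l\<close> with \<open>l\<close> linear (\<open>character_graph_exp\<close>).
  \<^item> Open sets and regular functions descend (\<open>invariant_relation_descends\<close>). A polynomial relation
    on an orbit splits into the components of its terms modulo \<open>L\<^sub>1\<^sup>*\<close>, by the linear independence of
    characters, and multiplication by a suitable monomial moves one component into \<open>\<complex>[S\<^sub>1]\<close>.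

  The charts are glued compatibly: an identification between charts for \<open>L\<^sub>1\<close> lifts to one for \<open>L\<close>
  (\<open>equivclp_glue_lift\<close>), provided that for a face \<open>\<tau>\<close> of \<open>\<sigma>\<close> the monoid \<open>S\<^sub>\<tau>\<close> arises from \<open>S\<^sub>\<sigma>\<close> by
  inverting an element of \<open>L\<^sub>1\<^sup>*\<close>. For the spanning fan of a reflexive polytope, such an element is a sum
  of differences of vertices of the polar dual (\<open>face_cone_separation\<close>).
\<close>

section \<open>Extension of characters\<close>

text \<open>
  The graph of a character with values in \<open>\<complex>\<^sup>*\<close>, defined on the subgroup of first components. As a
  graph, it can be enlarged without a choice of representatives; that it is single-valued only has
  to be checked at \<open>0\<close>, and values are then automatically nonzero.
\<close>

definition character_graph :: "('a::real_vector \<times> complex) set \<Rightarrow> bool" where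
  "character_graph \<Gamma> \<longleftrightarrow> (0, 1) \<in> \<Gamma> \<and>
     (\<forall>a c a' c'. (a, c) \<in> \<Gamma> \<longrightarrow> (a', c') \<in> \<Gamma> \<longrightarrow> (a - a', c / c') \<in> \<Gamma>) \<and>
     (\<forall>c. (0, c) \<in> \<Gamma> \<longrightarrow> c = 1)"

context
  fixes \<Gamma> :: "('a::real_vector \<times> complex) set"
  assumes \<Gamma>: "character_graph \<Gamma>"
begin

lemma character_graph_one: "(0, 1) \<in> \<Gamma>"
  and character_graph_diff: "(a, c) \<in> \<Gamma> \<Longrightarrow> (a', c') \<in> \<Gamma> \<Longrightarrow> (a - a', c / c') \<in> \<Gamma>"
  and character_graph_zero: "(0, c) \<in> \<Gamma> \<Longrightarrow> c = 1"
  using \<Gamma> unfolding character_graph_def by blast+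

lemma character_graph_nonzero: "(a, c) \<in> \<Gamma> \<Longrightarrow> c \<noteq> 0"
  using character_graph_diff[of a c a c] character_graph_zero[of "c / c"] by auto

lemma character_graph_unique: "(a, c) \<in> \<Gamma> \<Longrightarrow> (a, c') \<in> \<Gamma> \<Longrightarrow> c = c'"
  using character_graph_diff[of a c a c'] character_graph_zero[of "c / c'"]
    character_graph_nonzero[of a c'] by (auto simp: field_simps)

lemma character_graph_add:
  assumes "(a, c) \<in> \<Gamma>" "(a', c') \<in> \<Gamma>"
  shows "(a + a', c * c') \<in> \<Gamma>"
proof -
  have "(0 - a', 1 / c') \<in> \<Gamma>" by (rule character_graph_diff[OF character_graph_one assms(2)])
  from character_graph_diff[OF assms(1) this] show ?thesis by simp
qed

lemma character_graph_int_scale: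
  assumes "(a, c) \<in> \<Gamma>"
  shows "(of_int j *\<^sub>R a, c powi j) \<in> \<Gamma>"
proof -
  have nat: "(of_nat n *\<^sub>R a, c ^ n) \<in> \<Gamma>" for n
    using character_graph_add[OF assms] character_graph_one
    by (induction n) (auto simp: scaleR_add_left)
  show ?thesis
  proof (cases "j \<ge> 0")
    case True
    then show ?thesis using nat[of "nat j"] by (simp add: power_int_def)
  next
    case False
    then show ?thesis
      using character_graph_diff[OF character_graph_one nat[of "nat (- j)"]]
      by (simp add: power_int_def field_simps)
  qed
qed

text \<open>
  The value that an extension of the character must give to \<open>b\<close>. The multiples of \<open>b\<close> in the domain are
  those of some \<open>k b\<close>, and any \<open>k\<close>-th root of the value at \<open>k b\<close> works. If only \<open>0\<close> is such a multiple,
  any nonzero value works.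
\<close>

lemma character_graph_root:
  obtains z where "z \<noteq> 0" "\<And>j c. (of_int j *\<^sub>R b, c) \<in> \<Gamma> \<Longrightarrow> c = z powi j"
proof (cases "\<exists>k::nat. k > 0 \<and> (\<exists>c. (of_nat k *\<^sub>R b, c) \<in> \<Gamma>)")
  case True
  define k where "k = (LEAST k::nat. k > 0 \<and> (\<exists>c. (of_nat k *\<^sub>R b, c) \<in> \<Gamma>))"
  from LeastI_ex[OF True] obtain c0 where k: "k > 0" "(of_nat k *\<^sub>R b, c0) \<in> \<Gamma>"
    unfolding k_def[symmetric] by blast
  have least: "k \<le> i" if "i > 0" "(of_nat i *\<^sub>R b, c) \<in> \<Gamma>" for i c
    unfolding k_def using that by (intro Least_le) blast
  define z where "z = exp (Ln c0 / of_nat k)"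
  have c0: "c0 \<noteq> 0" using character_graph_nonzero[OF k(2)] .
  have zk: "z ^ k = c0" unfolding z_def using k(1) c0 by (simp flip: exp_of_nat_mult)
  have "c = z powi j" if jc: "(of_int j *\<^sub>R b, c) \<in> \<Gamma>" for j c
  proof -
    define q r where "q = j div int k" and "r = j mod int k"
    have j: "j = int k * q + r" and r: "0 \<le> r" "r < int k"
      using k(1) by (simp_all add: q_def r_def)
    have "(of_int q *\<^sub>R of_nat k *\<^sub>R b, c0 powi q) \<in> \<Gamma>"
      by (rule character_graph_int_scale[OF k(2)])
    from character_graph_diff[OF jc this]
    have rb: "(of_nat (nat r) *\<^sub>R b, c / c0 powi q) \<in> \<Gamma>"
      using r(1) by (simp add: j scaleR_add_left mult.commute)
    with least[of "nat r"] r have r0: "r = 0" by force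
    have "c / c0 powi q = 1" by (rule character_graph_zero) (use rb r0 in simp)
    then have "c = c0 powi q" using c0 by (simp add: field_simps)
    then show ?thesis by (simp add: j r0 power_int_mult zk)
  qed
  then show thesis by (intro that[of z]) (auto simp: z_def)
next
  case False
  have "c = 1 powi j" if jc: "(of_int j *\<^sub>R b, c) \<in> \<Gamma>" for j c
  proof -
    have "\<not> j > 0"
    proof
      assume "j > 0"
      with False jc show False by (metis of_int_of_nat_eq zero_less_imp_eq_int)
    qed
    moreover have "\<not> j < 0"
    proof
      assume "j < 0"
      have "(of_nat (nat (- j)) *\<^sub>R b, c powi - 1) \<in> \<Gamma>"
        using character_graph_int_scale[OF jc, of "- 1"] \<open>j < 0\<close> by simp
      moreover have "nat (- j) > 0" using \<open>j < 0\<close> by simp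
      ultimately show False using False by blast
    qed
    ultimately show ?thesis using jc character_graph_zero by (cases "j = 0") auto
  qed
  then show thesis by (intro that[of 1]) auto
qed

lemma character_graph_extend:
  obtains \<Gamma>' where "character_graph \<Gamma>'" "\<Gamma> \<subseteq> \<Gamma>'" "b \<in> fst ` \<Gamma>'"
proof -
  obtain z where z: "z \<noteq> 0" "\<And>j c. (of_int j *\<^sub>R b, c) \<in> \<Gamma> \<Longrightarrow> c = z powi j"
    using character_graph_root by blast
  define \<Gamma>' where "\<Gamma>' = {(a + of_int j *\<^sub>R b, c * z powi j) | a c j. (a, c) \<in> \<Gamma>}"
  have mem: "(a, c) \<in> \<Gamma> \<Longrightarrow> d = a + of_int j *\<^sub>R b \<Longrightarrow> e = c * z powi j \<Longrightarrow> (d, e) \<in> \<Gamma>'" for a c j d e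
    unfolding \<Gamma>'_def by blast
  show thesis
  proof (rule that)
    show "\<Gamma> \<subseteq> \<Gamma>'" using mem[of _ _ _ 0] by auto
    show "b \<in> fst ` \<Gamma>'"
      using mem[OF character_graph_one, of b 1] by force
    show "character_graph \<Gamma>'"
      unfolding character_graph_def
    proof (intro conjI allI impI)
      show "(0, 1) \<in> \<Gamma>'" using mem[OF character_graph_one, of 0 0] by simp
    next
      fix d e d' e' assume "(d, e) \<in> \<Gamma>'" "(d', e') \<in> \<Gamma>'"
      then obtain a c j a' c' j' where *: "(a, c) \<in> \<Gamma>" "(a', c') \<in> \<Gamma>" 
          "d = a + of_int j *\<^sub>R b" "e = c * z powi j" "d' = a' + of_int j' *\<^sub>R b" "e' = c' * z powi j'"
        unfolding \<Gamma>'_def by blast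
      show "(d - d', e / e') \<in> \<Gamma>'"
        by (rule mem[OF character_graph_diff[OF *(1,2)], of _ "j - j'"])
           (use z(1) in \<open>auto simp: * scaleR_diff_left power_int_diff\<close>)
    next
      fix e assume "(0, e) \<in> \<Gamma>'"
      then obtain a c j where *: "(a, c) \<in> \<Gamma>" "0 = a + of_int j *\<^sub>R b" "e = c * z powi j"
        unfolding \<Gamma>'_def by blast
      have "a = of_int (- j) *\<^sub>R b" using *(2) by (simp add: eq_neg_iff_add_eq_0)
      with *(1) z(2) have "c = z powi - j" by blast
      then show "e = 1" using z(1) by (simp add: *(3) power_int_minus)
    qed
  qed
qed

end

lemma character_graph_extend_finite:
  assumes "finite B" "character_graph \<Gamma>"
  obtains \<Gamma>' where "character_graph \<Gamma>'" "\<Gamma> \<subseteq> \<Gamma>'" "B \<subseteq> fst ` \<Gamma>'"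
  using assms
proof (induction B arbitrary: thesis)
  case (insert b B)
  obtain \<Gamma>1 where 1: "character_graph \<Gamma>1" "\<Gamma> \<subseteq> \<Gamma>1" "B \<subseteq> fst ` \<Gamma>1"
    using insert.IH insert.prems(2) by blast
  obtain \<Gamma>2 where 2: "character_graph \<Gamma>2" "\<Gamma>1 \<subseteq> \<Gamma>2" "b \<in> fst ` \<Gamma>2"
    using character_graph_extend[OF 1(1)] by blast
  then show ?case using 1 by (intro insert.prems(1)[of \<Gamma>2]) blast+
qed blast

text \<open>
  Extend the character to the basis \<open>B\<close> and take for \<open>l\<close> the linear map whose values on \<open>B\<close> are logarithms
  of the values of the extended character.
\<close>

lemma character_graph_exp:
  fixes B :: "'a::euclidean_space set"
  assumes "character_graph \<Gamma>" "independent B"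
  obtains l where "linear l" "\<And>a c. (a, c) \<in> \<Gamma> \<Longrightarrow> a \<in> int_span B \<Longrightarrow> c = exp (l a)"
proof -
  obtain \<Gamma>' where \<Gamma>': "character_graph \<Gamma>'" "\<Gamma> \<subseteq> \<Gamma>'" "B \<subseteq> fst ` \<Gamma>'"
    using character_graph_extend_finite[OF independent_imp_finite[OF assms(2)] assms(1)] by blast
  then have "\<forall>b\<in>B. \<exists>c. (b, c) \<in> \<Gamma>'" by force
  then obtain f where f: "\<And>b. b \<in> B \<Longrightarrow> (b, f b) \<in> \<Gamma>'" by metis
  obtain l where l: "linear l" "\<And>b. b \<in> B \<Longrightarrow> l b = Ln (f b)"
    using linear_independent_extend[OF assms(2), of "\<lambda>b. Ln (f b)"] by blast
  have base: "(b, exp (l b)) \<in> \<Gamma>'" if "b \<in> B" for b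
    using f[OF that] l(2)[OF that] character_graph_nonzero[OF \<Gamma>'(1) f[OF that]] by simp
  have span: "(\<Sum>v\<in>T. of_int (c v) *\<^sub>R v, exp (l (\<Sum>v\<in>T. of_int (c v) *\<^sub>R v))) \<in> \<Gamma>'"
    if "finite T" "T \<subseteq> B" for T c
    using that
  proof (induction T)
    case empty
    then show ?case using character_graph_one[OF \<Gamma>'(1)] linear_0[OF l(1)] by simp
  next
    case (insert v T)
    have "exp (l v) powi c v = exp (l (of_int (c v) *\<^sub>R v))"
      using linear_scale[OF l(1), of "of_int (c v)" v]
      by (simp add: scaleR_conv_of_real exp_power_int)
    then have "(of_int (c v) *\<^sub>R v, exp (l (of_int (c v) *\<^sub>R v))) \<in> \<Gamma>'"
      using character_graph_int_scale[OF \<Gamma>'(1) base, of v "c v"] insert.prems by auto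
    from character_graph_add[OF \<Gamma>'(1) this insert.IH] insert show ?case
      by (simp add: linear_add[OF l(1)] exp_add)
  qed
  have "c = exp (l a)" if "(a, c) \<in> \<Gamma>" "a \<in> int_span B" for a c
    using that span \<Gamma>'(2) character_graph_unique[OF \<Gamma>'(1)] unfolding int_span_def by blast
  with l(1) show thesis by (rule that)
qed

section \<open>Full lattices and their duals\<close>
lemma int_span_base: "v \<in> S \<Longrightarrow> v \<in> int_span S"
  unfolding int_span_def mem_Collect_eq by (rule exI[of _ "{v}"], rule exI[of _ "\<lambda>_. 1"]) simp

lemma dual_lattice_int_span: "dual_lattice (int_span S) = {m. \<forall>v\<in>S. m \<bullet> v \<in> \<int>}"
proof (intro subset_antisym subsetI CollectI ballI)
  fix m v assume m: "m \<in> dual_lattice (int_span S)" and v: "v \<in> S"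
  from m int_span_base[OF v] show "m \<bullet> v \<in> \<int>" by (simp add: dual_lattice_def)
next
  fix m assume "m \<in> {m. \<forall>v\<in>S. m \<bullet> v \<in> \<int>}"
  then show "m \<in> dual_lattice (int_span S)"
    by (force simp: dual_lattice_def int_span_def inner_sum_right intro!: Ints_sum Ints_mult)
qed

lemma dual_lattice_zero: "0 \<in> dual_lattice L"
  and dual_lattice_add: "m \<in> dual_lattice L \<Longrightarrow> m' \<in> dual_lattice L \<Longrightarrow> m + m' \<in> dual_lattice L"
  and dual_lattice_diff: "m \<in> dual_lattice L \<Longrightarrow> m' \<in> dual_lattice L \<Longrightarrow> m - m' \<in> dual_lattice L"
  and dual_lattice_int_scale: "m \<in> dual_lattice L \<Longrightarrow> of_int j *\<^sub>R m \<in> dual_lattice L"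
  by (auto simp: dual_lattice_def inner_add_left inner_diff_left)

lemma dual_lattice_sum: "(\<And>i. i \<in> I \<Longrightarrow> f i \<in> dual_lattice L) \<Longrightarrow> sum f I \<in> dual_lattice L"
  by (auto simp: dual_lattice_def inner_sum_left intro!: Ints_sum)

lemma dual_lattice_nat_scale: "m \<in> dual_lattice L \<Longrightarrow> of_nat k *\<^sub>R m \<in> dual_lattice L"
  using dual_lattice_int_scale[of m L "int k"] by simp

lemma dual_basis:
  fixes B :: "'a::euclidean_space set"
  assumes "independent B" "span B = UNIV"
  obtains d where "\<And>b b'. b \<in> B \<Longrightarrow> b' \<in> B \<Longrightarrow> d b \<bullet> b' = (if b = b' then 1 else 0)"
    "\<And>m. m = (\<Sum>b\<in>B. (m \<bullet> b) *\<^sub>R d b)" "\<And>m. m = (\<Sum>b\<in>B. (m \<bullet> d b) *\<^sub>R b)"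
proof -
  have fin: "finite B" using independent_imp_finite[OF assms(1)] .
  have "\<exists>w. \<forall>b'\<in>B. w \<bullet> b' = (if b = b' then 1 else 0)" for b
  proof -
    obtain f :: "'a \<Rightarrow> real" where f: "linear f" "\<forall>b'\<in>B. f b' = (if b = b' then 1 else 0)"
      using linear_independent_extend[OF assms(1), of "\<lambda>b'. if b = b' then 1 else 0"] by (elim exE conjE)
    have "adjoint f 1 \<bullet> x = f x" for x
      using adjoint_works[OF f(1), of x 1] inner_commute[of x "adjoint f 1"] by simp
    with f(2) show ?thesis by metis
  qed
  then obtain d where d: "\<And>b b'. b' \<in> B \<Longrightarrow> d b \<bullet> b' = (if b = b' then 1 else 0)" by metis
  have 1: "m = (\<Sum>b\<in>B. (m \<bullet> b) *\<^sub>R d b)" for m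
  proof -
    let ?w = "m - (\<Sum>b\<in>B. (m \<bullet> b) *\<^sub>R d b)"
    have "?w \<bullet> b = 0" if "b \<in> B" for b
      using that fin by (simp add: inner_diff_left inner_sum_left d if_distrib cong: if_cong)
    then have "orthogonal ?w v" if "v \<in> span B" for v
      using orthogonal_to_span[OF that, of ?w] by (simp add: orthogonal_def)
    then have "orthogonal ?w ?w" using assms(2) by blast
    then show ?thesis by (simp add: orthogonal_def)
  qed
  have 2: "m = (\<Sum>b\<in>B. (m \<bullet> d b) *\<^sub>R b)" for m
  proof -
    obtain u where u: "m = (\<Sum>b\<in>B. u b *\<^sub>R b)"
      using assms(2) span_finite[OF fin] UNIV_I[of m] by auto
    have "m \<bullet> d b = u b" if "b \<in> B" for b
    proof -
      have "d b \<bullet> m = (\<Sum>c\<in>B. if b = c then u c else 0)"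
        unfolding u inner_sum_right by (rule sum.cong) (use d in auto)
      then show ?thesis using that fin by (simp add: inner_commute)
    qed
    then have "(\<Sum>b\<in>B. (m \<bullet> d b) *\<^sub>R b) = (\<Sum>b\<in>B. u b *\<^sub>R b)" by simp
    then show ?thesis using u by simp
  qed
  show thesis using that[of d] d 1 2 by blast
qed

lemma full_lattice_dual:
  assumes "full_lattice L"
  shows "full_lattice (dual_lattice L)"
proof -
  obtain B where B: "independent B" "span B = UNIV" "L = int_span B"
    using assms unfolding full_lattice_def by blast
  obtain d where d: "\<And>b b'. b \<in> B \<Longrightarrow> b' \<in> B \<Longrightarrow> d b \<bullet> b' = (if b = b' then 1 else 0)"
    "\<And>m. m = (\<Sum>b\<in>B. (m \<bullet> b) *\<^sub>R d b)"
    using dual_basis[OF B(1,2)] by metis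
  have fin: "finite B" using independent_imp_finite[OF B(1)] .
  have inj: "inj_on d B"
    by (rule inj_onI) (metis d(1) zero_neq_one)
  have "independent (d ` B)"
  proof (rule independent_if_scalars_zero)
    fix f x assume *: "(\<Sum>x\<in>d ` B. f x *\<^sub>R x) = 0" "x \<in> d ` B"
    then obtain b where b: "b \<in> B" "x = d b" by blast
    have "0 = (\<Sum>x\<in>d ` B. f x *\<^sub>R x) \<bullet> b" using * by simp
    also have "\<dots> = (\<Sum>c\<in>B. f (d c) * (d c \<bullet> b))" by (simp add: sum.reindex[OF inj] inner_sum_left)
    also have "\<dots> = (\<Sum>c\<in>B. if c = b then f (d c) else 0)"
      by (rule sum.cong) (use d(1) b in auto)
    finally show "f x = 0" using b fin by simp
  qed (simp add: fin)
  moreover have "span (d ` B) = UNIV"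
  proof -
    have "m \<in> span (d ` B)" for m
      by (subst d(2)) (intro span_sum span_scale span_base imageI)
    then show ?thesis by blast
  qed
  moreover have "dual_lattice L = int_span (d ` B)"
  proof (intro subset_antisym subsetI)
    fix m assume "m \<in> dual_lattice L"
    then have "m \<bullet> b \<in> \<int>" if "b \<in> B" for b using that by (simp add: B(3) dual_lattice_int_span)
    then have eq: "(\<Sum>b\<in>B. (m \<bullet> b) *\<^sub>R d b) = (\<Sum>b\<in>B. of_int \<lfloor>m \<bullet> b\<rfloor> *\<^sub>R d b)"
      by (intro sum.cong refl) (auto elim!: Ints_cases)
    have "m = (\<Sum>v\<in>d ` B. of_int \<lfloor>m \<bullet> the_inv_into B d v\<rfloor> *\<^sub>R v)"
      using d(2)[of m] by (simp add: sum.reindex[OF inj] the_inv_into_f_f[OF inj] eq)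
    then show "m \<in> int_span (d ` B)"
      unfolding int_span_def mem_Collect_eq using fin
      by (intro exI[of _ "d ` B"] exI[of _ "\<lambda>v. \<lfloor>m \<bullet> the_inv_into B d v\<rfloor>"]) simp
  next
    fix m assume "m \<in> int_span (d ` B)"
    then have "b \<bullet> m \<in> \<int>" if "b \<in> dual_lattice (int_span (d ` B))" for b
      using that by (auto simp: dual_lattice_def)
    moreover have "b \<in> dual_lattice (int_span (d ` B))" if "b \<in> B" for b
      using that by (auto simp: dual_lattice_int_span d(1) inner_commute[of b])
    ultimately show "m \<in> dual_lattice L" by (auto simp: B(3) dual_lattice_int_span inner_commute[of m])
  qed
  ultimately show ?thesis unfolding full_lattice_def by blast
qed

lemma dual_dual_lattice:
  assumes "full_lattice L"
  shows "dual_lattice (dual_lattice L) = L"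
proof (intro subset_antisym subset_dual_dual_lattice subsetI)
  fix m assume m: "m \<in> dual_lattice (dual_lattice L)"
  obtain B where B: "independent B" "span B = UNIV" "L = int_span B"
    using assms unfolding full_lattice_def by blast
  obtain d where d: "\<And>b b'. b \<in> B \<Longrightarrow> b' \<in> B \<Longrightarrow> d b \<bullet> b' = (if b = b' then 1 else 0)"
    "\<And>m. m = (\<Sum>b\<in>B. (m \<bullet> d b) *\<^sub>R b)"
    using dual_basis[OF B(1,2)] by metis
  have "d b \<in> dual_lattice L" if "b \<in> B" for b
    using that by (auto simp: B(3) dual_lattice_int_span d(1))
  then have "m \<bullet> d b \<in> \<int>" if "b \<in> B" for b using m that by (simp add: dual_lattice_def)
  then have "(\<Sum>b\<in>B. (m \<bullet> d b) *\<^sub>R b) = (\<Sum>b\<in>B. of_int \<lfloor>m \<bullet> d b\<rfloor> *\<^sub>R b)"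
    by (intro sum.cong refl) (auto elim!: Ints_cases)
  with d(2)[of m] have "m = (\<Sum>b\<in>B. of_int \<lfloor>m \<bullet> d b\<rfloor> *\<^sub>R b)" by simp
  then show "m \<in> L"
    unfolding B(3) int_span_def mem_Collect_eq using independent_imp_finite[OF B(1)]
    by (intro exI[of _ B] exI[of _ "\<lambda>b. \<lfloor>m \<bullet> d b\<rfloor>"]) simp
qed

lemma exp_linear_trivial_imp_Re_zero:
  fixes l :: "'a::euclidean_space \<Rightarrow> complex"
  assumes "linear l" "span B = UNIV" "\<And>b. b \<in> B \<Longrightarrow> exp (l b) = 1"
  shows "Re (l v) = 0"
proof -
  have lin: "linear (\<lambda>v. Re (l v))"
    using linear_compose[OF assms(1) bounded_linear.linear[OF bounded_linear_Re]] by (simp add: o_def)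
  have "Re (l b) = 0" if "b \<in> B" for b
    using assms(3)[OF that] norm_exp_eq_Re[of "l b"] by simp
  from linear_eq_0_on_span[OF lin this, where b = B] show ?thesis using assms(2) by blast
qed

text \<open>
  A character argument replaces the finiteness of the index: if no positive multiple of \<open>v\<close> were in \<open>K\<close>,
  there would be a character of \<open>K + \<int> v\<close> that is trivial on \<open>K\<close> and takes the value \<open>2\<close> at \<open>v\<close>. It would
  have the form \<open>exp \<circ> l\<close>, where the real part of \<open>l\<close> vanishes on \<open>K\<close>, hence everywhere, contradicting
  \<open>\<bar>2\<bar> \<noteq> 1\<close>.
\<close>

lemma multiple_in_full_sublattice:
  fixes K :: "'a::euclidean_space set"
  assumes "full_lattice K" "full_lattice K'" "K \<subseteq> K'" "v \<in> K'"
  shows "\<exists>k::nat. k > 0 \<and> of_nat k *\<^sub>R v \<in> K"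
proof (rule ccontr)
  assume no: "\<not> ?thesis"
  obtain B where B: "independent B" "span B = UNIV" "K = int_span B"
    using assms(1) unfolding full_lattice_def by blast
  obtain B' where B': "independent B'" "K' = int_span B'"
    using assms(2) unfolding full_lattice_def by blast
  have K: "0 \<in> K" "a \<in> K \<Longrightarrow> a' \<in> K \<Longrightarrow> a - a' \<in> K" "a \<in> K \<Longrightarrow> of_int j *\<^sub>R a \<in> K" for a a' j
    using dual_lattice_zero[of "dual_lattice K"] dual_lattice_diff[of a "dual_lattice K" a']
      dual_lattice_int_scale[of a "dual_lattice K" j] dual_dual_lattice[OF assms(1)] by simp_all
  have K': "a \<in> K' \<Longrightarrow> a' \<in> K' \<Longrightarrow> a + a' \<in> K'" for a a'
    using dual_lattice_add[of a "dual_lattice K'" a'] dual_dual_lattice[OF assms(2)] by simp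
  define \<Gamma> where "\<Gamma> = {(a + of_int j *\<^sub>R v, 2 powi j :: complex) | a j. a \<in> K}"
  have mem: "a \<in> K \<Longrightarrow> e = a + of_int j *\<^sub>R v \<Longrightarrow> c = 2 powi j \<Longrightarrow> (e, c) \<in> \<Gamma>" for a e c j
    unfolding \<Gamma>_def by blast
  have "character_graph \<Gamma>"
    unfolding character_graph_def
  proof (intro conjI allI impI)
    show "(0, 1) \<in> \<Gamma>" using mem[OF K(1), of 0 0 1] by simp
  next
    fix e c e' c' assume "(e, c) \<in> \<Gamma>" "(e', c') \<in> \<Gamma>"
    then obtain a j a' j' where *: "a \<in> K" "e = a + of_int j *\<^sub>R v" "c = 2 powi j"
        "a' \<in> K" "e' = a' + of_int j' *\<^sub>R v" "c' = 2 powi j'"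
      unfolding \<Gamma>_def by blast
    show "(e - e', c / c') \<in> \<Gamma>"
      by (rule mem[OF K(2)[OF *(1,4)], of _ "j - j'"]) (simp_all add: * scaleR_diff_left power_int_diff)
  next
    fix c assume "(0, c) \<in> \<Gamma>"
    then obtain a j where *: "a \<in> K" "0 = a + of_int j *\<^sub>R v" "c = 2 powi j"
      unfolding \<Gamma>_def by blast
    have "of_int j *\<^sub>R v = 0 - a" using *(2) by (simp add: eq_neg_iff_add_eq_0 add.commute)
    then have jv: "of_int j *\<^sub>R v \<in> K" using K(1,2) *(1) by metis
    have "of_int (j * sgn j) *\<^sub>R v \<in> K"
      using K(3)[OF jv, of "sgn j"] by (simp add: mult.commute)
    moreover have "real (nat \<bar>j\<bar>) = of_int (j * sgn j)" by (simp add: abs_if sgn_if)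
    ultimately have "of_nat (nat \<bar>j\<bar>) *\<^sub>R v \<in> K" by simp
    then have "j = 0" using no by (metis zero_less_nat_eq zero_less_abs_iff)
    then show "c = 1" by (simp add: *)
  qed
  then obtain l where l: "linear l" "\<And>a c. (a, c) \<in> \<Gamma> \<Longrightarrow> a \<in> K' \<Longrightarrow> c = exp (l a)"
    using character_graph_exp B' by blast
  have "exp (l b) = 1" if "b \<in> B" for b
  proof -
    have "b \<in> K" unfolding B(3) by (rule int_span_base[OF that])
    then show ?thesis using l(2)[OF mem[of b _ 0 1]] assms(3) by auto
  qed
  then have "Re (l v) = 0" by (rule exp_linear_trivial_imp_Re_zero[OF l(1) B(2)])
  moreover have "2 = exp (l v)" by (rule l(2)[OF mem[OF K(1), of _ 1]]) (use assms(4) in auto)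
  then have "norm (exp (l v)) = 2" by (metis norm_numeral)
  ultimately show False by simp
qed

text \<open>
  The smaller lattice enters through its dual and through a basis of the space contained in it. It may
  thus be given by generators, like the lattice spanned by the vertices of a polytope.
\<close>

locale lattice_inclusion =
  fixes L L\<^sub>1 :: "'a::euclidean_space set"
  assumes full: "full_lattice L\<^sub>1" and zero_mem: "0 \<in> L" and spanning: "span L = UNIV"
    and subset: "L \<subseteq> L\<^sub>1"
begin

lemma L1_closed: "0 \<in> L\<^sub>1" "a \<in> L\<^sub>1 \<Longrightarrow> b \<in> L\<^sub>1 \<Longrightarrow> a + b \<in> L\<^sub>1" "a \<in> L\<^sub>1 \<Longrightarrow> b \<in> L\<^sub>1 \<Longrightarrow> a - b \<in> L\<^sub>1"
  using dual_lattice_zero[of "dual_lattice L\<^sub>1"] dual_lattice_add[of a "dual_lattice L\<^sub>1" b]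
    dual_lattice_diff[of a "dual_lattice L\<^sub>1" b] dual_dual_lattice[OF full] by simp_all

lemma dual_in_full_lattice:
  obtains K where "full_lattice K" "dual_lattice L \<subseteq> K"
proof -
  obtain B where B: "B \<subseteq> L" "independent B" "L \<subseteq> span B"
    using maximal_independent_subset[of L] by blast
  have "span B = UNIV" using spanning span_mono[OF B(3)] by (simp add: span_span top.extremum_unique)
  then have "full_lattice (int_span B)" using B unfolding full_lattice_def by blast
  moreover have "dual_lattice L \<subseteq> dual_lattice (int_span B)"
    unfolding dual_lattice_int_span using B(1) by (auto simp: dual_lattice_def)
  ultimately show thesis using that full_lattice_dual by blast
qed

text \<open>
  The group \<open>L\<^sup>* / L\<^sub>1\<^sup>*\<close> is torsion. This is the form in which the finiteness of \<open>L\<^sub>1 / L\<close> enters all that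
  follows.
\<close>

lemma multiple_in_dual:
  assumes "m \<in> dual_lattice L"
  obtains k :: nat where "k > 0" "of_nat k *\<^sub>R m \<in> dual_lattice L\<^sub>1"
proof -
  obtain K where K: "full_lattice K" "dual_lattice L \<subseteq> K" by (rule dual_in_full_lattice)
  have "dual_lattice L\<^sub>1 \<subseteq> K" using K(2) dual_lattice_antimono[OF subset] by blast
  with multiple_in_full_sublattice[OF full_lattice_dual[OF full] K(1)] K(2) assms that
  show thesis by blast
qed

lemma character_graph_dual:
  assumes "character_graph \<Gamma>" "fst ` \<Gamma> \<subseteq> dual_lattice L"
  obtains l where "linear l" "\<And>a c. (a, c) \<in> \<Gamma> \<Longrightarrow> c = exp (l a)"
proof -
  obtain K where K: "full_lattice K" "dual_lattice L \<subseteq> K" by (rule dual_in_full_lattice)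
  then obtain B where B: "independent B" "K = int_span B" unfolding full_lattice_def by blast
  obtain l where l: "linear l" "\<And>a c. (a, c) \<in> \<Gamma> \<Longrightarrow> a \<in> int_span B \<Longrightarrow> c = exp (l a)"
    using character_graph_exp[OF assms(1) B(1)] by blast
  have "c = exp (l a)" if "(a, c) \<in> \<Gamma>" for a c
  proof (rule l(2)[OF that])
    have "a \<in> fst ` \<Gamma>" using that by force
    then show "a \<in> int_span B" using assms(2) K(2) B(2) by blast
  qed
  with l(1) show thesis by (rule that)
qed

end

section \<open>The quotient map on a chart\<close>
lemma cone_monoid_nat_scale:
  assumes "m \<in> cone_monoid L \<sigma>"
  shows "of_nat k *\<^sub>R m \<in> cone_monoid L \<sigma>"
  using assms dual_lattice_nat_scale[of m L k] by (auto simp: cone_monoid_def dual_cone_def)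

lemma affine_chart_one: "x \<in> affine_chart L \<sigma> \<Longrightarrow> x 0 = 1"
  and affine_chart_add:
    "x \<in> affine_chart L \<sigma> \<Longrightarrow> m \<in> cone_monoid L \<sigma> \<Longrightarrow> m' \<in> cone_monoid L \<sigma> \<Longrightarrow> x (m + m') = x m * x m'"
  by (auto simp: affine_chart_def)

lemma affine_chart_nat_scale:
  assumes "x \<in> affine_chart L \<sigma>" "m \<in> cone_monoid L \<sigma>"
  shows "x (of_nat k *\<^sub>R m) = x m ^ k"
  by (induction k)
     (simp_all add: affine_chart_one[OF assms(1)] scaleR_add_left
        affine_chart_add[OF assms(1,2) cone_monoid_nat_scale[OF assms(2)]])

lemma affine_chart_eqI:
  assumes "x \<in> affine_chart L \<sigma>" "x' \<in> affine_chart L \<sigma>" "\<And>m. m \<in> cone_monoid L \<sigma> \<Longrightarrow> x m = x' m"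
  shows "x = x'"
  using assms by (auto simp: affine_chart_def intro: extensionalityI)

abbreviation translate :: "'a::euclidean_space set \<Rightarrow> 'a set \<Rightarrow> 'a \<Rightarrow> ('a \<Rightarrow> complex) \<Rightarrow> 'a \<Rightarrow> complex" where
  "translate L \<sigma> n x \<equiv> snd (chart_act L n (\<sigma>, x))"

lemma translate_apply: "m \<in> cone_monoid L \<sigma> \<Longrightarrow> translate L \<sigma> n x m = cis (2 * pi * (m \<bullet> n)) * x m"
  by (simp add: chart_act_def)

lemma cis_2pi_eq_1_iff: "cis (2 * pi * t) = 1 \<longleftrightarrow> t \<in> \<int>"
proof
  assume "cis (2 * pi * t) = 1"
  then have "cos (2 * pi * t) = 1" by (simp add: complex_eq_iff)
  then obtain j :: int where "2 * pi * t = of_int j * 2 * pi" by (auto simp: cos_one_2pi_int)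
  then have "t = of_int j" by simp
  then show "t \<in> \<int>" by simp
qed (rule cis_multiple_2pi)

context lattice_inclusion
begin

lemma cone_monoid_subset: "cone_monoid L\<^sub>1 \<sigma> \<subseteq> cone_monoid L \<sigma>"
  using dual_lattice_antimono[OF subset] by (auto simp: cone_monoid_def)

lemma cone_monoid_dual: "m \<in> cone_monoid L \<sigma> \<Longrightarrow> m \<in> dual_lattice L\<^sub>1 \<Longrightarrow> m \<in> cone_monoid L\<^sub>1 \<sigma>"
  by (simp add: cone_monoid_def)

lemma multiple_in_cone_monoid:
  assumes "m \<in> cone_monoid L \<sigma>"
  obtains k :: nat where "k > 0" "of_nat k *\<^sub>R m \<in> cone_monoid L\<^sub>1 \<sigma>"
proof -
  have "m \<in> dual_lattice L" using assms by (simp add: cone_monoid_def)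
  from multiple_in_dual[OF this] show thesis
    using that cone_monoid_dual[OF cone_monoid_nat_scale[OF assms]] by blast
qed

lemma restrict_chart:
  assumes "x \<in> affine_chart L \<sigma>"
  shows "restrict x (cone_monoid L\<^sub>1 \<sigma>) \<in> affine_chart L\<^sub>1 \<sigma>"
  using assms cone_monoid_subset[of \<sigma>]
  by (auto simp: affine_chart_def zero_in_cone_monoid cone_monoid_add subset_iff)

lemma restrict_translate:
  assumes "n \<in> L\<^sub>1"
  shows "restrict (translate L \<sigma> n x) (cone_monoid L\<^sub>1 \<sigma>) = restrict x (cone_monoid L\<^sub>1 \<sigma>)"
proof -
  have "translate L \<sigma> n x m = x m" if "m \<in> cone_monoid L\<^sub>1 \<sigma>" for m
  proof -
    have "m \<bullet> n \<in> \<int>" using that assms by (simp add: cone_monoid_def dual_lattice_def)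
    then show ?thesis using that cone_monoid_subset[of \<sigma>] by (auto simp: translate_apply cis_2pi_eq_1_iff)
  qed
  then show ?thesis by (auto simp: restrict_def)
qed

text \<open>
  On the elements \<open>T\<close> of \<open>S\<^sub>1\<close> where \<open>y\<close> does not vanish, \<open>y\<close> is a character \<open>exp \<circ> l\<close>. The point
  \<open>x\<close> is \<open>exp \<circ> l\<close> on the elements of \<open>S\<close> with a positive multiple in \<open>T\<close>, and \<open>0\<close> elsewhere.
\<close>

lemma extend_chart_point:
  assumes y: "y \<in> affine_chart L\<^sub>1 \<sigma>"
  obtains x where "x \<in> affine_chart L \<sigma>" "restrict x (cone_monoid L\<^sub>1 \<sigma>) = y"
proof -
  let ?S = "cone_monoid L \<sigma>" and ?S1 = "cone_monoid L\<^sub>1 \<sigma>"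
  define T where "T = {m \<in> ?S1. y m \<noteq> 0}"
  have T: "0 \<in> T" "\<And>t t'. t \<in> T \<Longrightarrow> t' \<in> T \<Longrightarrow> t + t' \<in> T"
    using affine_chart_one[OF y] affine_chart_add[OF y]
    by (auto simp: T_def zero_in_cone_monoid cone_monoid_add)
  have T_factor: "m \<in> T" if "m \<in> ?S1" "m' \<in> ?S1" "m + m' \<in> T" for m m'
    using that affine_chart_add[OF y that(1,2)] by (simp add: T_def)
  have T_scale: "of_nat k *\<^sub>R t \<in> T" if "t \<in> T" for k t
    using that affine_chart_nat_scale[OF y, of t k] by (simp add: T_def cone_monoid_nat_scale)
  define \<Gamma> where "\<Gamma> = {(t - t', y t / y t') | t t'. t \<in> T \<and> t' \<in> T}"
  have mem: "t \<in> T \<Longrightarrow> t' \<in> T \<Longrightarrow> a = t - t' \<Longrightarrow> c = y t / y t' \<Longrightarrow> (a, c) \<in> \<Gamma>" for t t' a c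
    unfolding \<Gamma>_def by blast
  have "character_graph \<Gamma>"
    unfolding character_graph_def
  proof (intro conjI allI impI)
    show "(0, 1) \<in> \<Gamma>" using mem[OF T(1) T(1), of 0 1] affine_chart_one[OF y] by simp
  next
    fix a c a' c' assume "(a, c) \<in> \<Gamma>" "(a', c') \<in> \<Gamma>"
    then obtain t s t' s' where *: "t \<in> T" "s \<in> T" "t' \<in> T" "s' \<in> T"
        "a = t - s" "c = y t / y s" "a' = t' - s'" "c' = y t' / y s'"
      unfolding \<Gamma>_def by blast
    show "(a - a', c / c') \<in> \<Gamma>"
      by (rule mem[OF T(2)[OF *(1,4)] T(2)[OF *(2,3)]])
         (use * affine_chart_add[OF y] in \<open>auto simp: T_def\<close>)
  next
    fix c assume "(0, c) \<in> \<Gamma>"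
    then show "c = 1" unfolding \<Gamma>_def T_def by auto
  qed
  moreover have "fst ` \<Gamma> \<subseteq> dual_lattice L"
    using cone_monoid_subset[of \<sigma>]
    by (auto simp: \<Gamma>_def T_def cone_monoid_def intro!: dual_lattice_diff)
  ultimately obtain l where l: "linear l" "\<And>a c. (a, c) \<in> \<Gamma> \<Longrightarrow> c = exp (l a)"
    using character_graph_dual[of \<Gamma>] by blast
  have yl: "y t = exp (l t)" if "t \<in> T" for t
    using l(2)[OF mem[OF that T(1) refl refl]] affine_chart_one[OF y] by simp
  define U where "U = {m \<in> ?S. \<exists>k::nat. k > 0 \<and> of_nat k *\<^sub>R m \<in> T}"
  \<comment> \<open>The complement of \<open>U\<close> is a prime ideal of \<open>S\<close>, so extension by zero is multiplicative.\<close>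
  have U_add: "m + m' \<in> U \<longleftrightarrow> m \<in> U \<and> m' \<in> U" if m: "m \<in> ?S" "m' \<in> ?S" for m m'
  proof
    assume "m + m' \<in> U"
    then obtain k :: nat where k: "k > 0" "of_nat k *\<^sub>R (m + m') \<in> T" unfolding U_def by blast
    have aux: "u \<in> U" if uw: "u \<in> ?S" "w \<in> ?S" "of_nat k *\<^sub>R (u + w) \<in> T" for u w
    proof -
      obtain i :: nat where i: "i > 0" "of_nat i *\<^sub>R u \<in> ?S1" by (rule multiple_in_cone_monoid[OF uw(1)])
      obtain j :: nat where j: "j > 0" "of_nat j *\<^sub>R w \<in> ?S1" by (rule multiple_in_cone_monoid[OF uw(2)])
      have "of_nat (k * i * j) *\<^sub>R u + of_nat (k * i * j) *\<^sub>R w \<in> T"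
        using T_scale[OF uw(3), of "i * j"] by (simp add: scaleR_add_right mult_ac)
      moreover have "of_nat (k * i * j) *\<^sub>R u \<in> ?S1" "of_nat (k * i * j) *\<^sub>R w \<in> ?S1"
        using cone_monoid_nat_scale[OF i(2), of "k * j"] cone_monoid_nat_scale[OF j(2), of "k * i"]
        by (simp_all add: mult_ac)
      ultimately have "of_nat (k * i * j) *\<^sub>R u \<in> T" by (rule T_factor[rotated 2])
      moreover have "k * i * j > 0" using k(1) i(1) j(1) by simp
      ultimately show ?thesis using uw(1) unfolding U_def by blast
    qed
    show "m \<in> U \<and> m' \<in> U" using aux[of m m'] aux[of m' m] m k(2) by (simp add: add.commute)
  next
    assume "m \<in> U \<and> m' \<in> U"
    then obtain i j :: nat where ij: "i > 0" "of_nat i *\<^sub>R m \<in> T" "j > 0" "of_nat j *\<^sub>R m' \<in> T"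
      unfolding U_def by blast
    have "of_nat (i * j) *\<^sub>R (m + m') \<in> T"
      using T(2)[OF T_scale[OF ij(2), of j] T_scale[OF ij(4), of i]]
      by (simp add: scaleR_add_right mult_ac)
    moreover have "i * j > 0" using ij(1,3) by simp
    ultimately show "m + m' \<in> U" using cone_monoid_add[OF m] unfolding U_def by blast
  qed
  have U_S1: "m \<in> U \<longleftrightarrow> m \<in> T" if "m \<in> ?S1" for m
  proof
    assume "m \<in> U"
    then obtain k :: nat where "k > 0" "of_nat k *\<^sub>R m \<in> T" unfolding U_def by blast
    then show "m \<in> T" using affine_chart_nat_scale[OF y that, of k] that by (auto simp: T_def)
  next
    assume "m \<in> T"
    then show "m \<in> U"
      using that cone_monoid_subset[of \<sigma>] unfolding U_def by (auto intro!: exI[of _ 1])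
  qed
  define x where "x = (\<lambda>m\<in>?S. if m \<in> U then exp (l m) else 0)"
  show thesis
  proof (rule that)
    have "0 \<in> U" using U_S1[of 0] T(1) by (simp add: zero_in_cone_monoid)
    then show "x \<in> affine_chart L \<sigma>"
      using linear_0[OF l(1)]
      by (auto simp: affine_chart_def x_def zero_in_cone_monoid cone_monoid_add U_add
          linear_add[OF l(1)] exp_add)
    show "restrict x ?S1 = y"
    proof (rule affine_chart_eqI[OF restrict_chart[OF \<open>x \<in> affine_chart L \<sigma>\<close>] y])
      fix m assume m: "m \<in> ?S1"
      then have "m \<in> ?S" using cone_monoid_subset[of \<sigma>] by blast
      then show "restrict x ?S1 m = y m"
        using m U_S1[OF m] yl[of m] by (auto simp: x_def T_def)
    qed
  qed
qed

text \<open>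
  Both points vanish at the same elements of \<open>S\<close>, since they agree on multiples. Their ratio is a
  character, where it is defined, and only depends on classes modulo \<open>L\<^sub>1\<^sup>*\<close>. Hence it extends to \<open>exp \<circ> l\<close>
  with \<open>l\<close> linear and \<open>exp \<circ> l\<close> trivial on \<open>L\<^sub>1\<^sup>*\<close>; such an \<open>l\<close> is \<open>2 \<pi> \<i>\<close> times the pairing with an element
  of the double dual of \<open>L\<^sub>1\<close>.
\<close>

lemma chart_fibre_is_orbit:
  assumes x: "x \<in> affine_chart L \<sigma>" and x': "x' \<in> affine_chart L \<sigma>"
    and eq: "restrict x (cone_monoid L\<^sub>1 \<sigma>) = restrict x' (cone_monoid L\<^sub>1 \<sigma>)"
  obtains n where "n \<in> L\<^sub>1" "x' = translate L \<sigma> n x"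
proof -
  let ?S = "cone_monoid L \<sigma>" and ?S1 = "cone_monoid L\<^sub>1 \<sigma>"
  have eq1: "x m = x' m" if "m \<in> ?S1" for m using fun_cong[OF eq, of m] that by simp
  have zero_iff: "x m = 0 \<longleftrightarrow> x' m = 0" if m: "m \<in> ?S" for m
  proof -
    obtain k :: nat where k: "k > 0" "of_nat k *\<^sub>R m \<in> ?S1" by (rule multiple_in_cone_monoid[OF m])
    then have "x m ^ k = x' m ^ k"
      using eq1[OF k(2)] affine_chart_nat_scale[OF x m, of k] affine_chart_nat_scale[OF x' m, of k] by simp
    then show ?thesis using k(1) by (metis power_eq_0_iff)
  qed
  define T where "T = {m \<in> ?S. x m \<noteq> 0}"
  define r where "r m = x' m / x m" for m
  have T0: "0 \<in> T" and r0: "r 0 = 1"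
    using affine_chart_one[OF x] affine_chart_one[OF x'] by (auto simp: T_def r_def zero_in_cone_monoid)
  have T_add: "t + t' \<in> T" and r_add: "r (t + t') = r t * r t'" if "t \<in> T" "t' \<in> T" for t t'
    using that affine_chart_add[OF x, of t t'] affine_chart_add[OF x', of t t']
    by (auto simp: T_def r_def cone_monoid_add)
  have r_nz: "r t \<noteq> 0" if "t \<in> T" for t using that zero_iff[of t] by (auto simp: T_def r_def)
  have T_scale: "of_nat k *\<^sub>R t \<in> T" and r_scale: "r (of_nat k *\<^sub>R t) = r t ^ k" if "t \<in> T" for k t
    using that affine_chart_nat_scale[OF x, of t k] affine_chart_nat_scale[OF x', of t k]
    by (auto simp: T_def r_def cone_monoid_nat_scale power_divide)
  have r_trivial: "r t = 1" if "t \<in> T" "t \<in> dual_lattice L\<^sub>1" for t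
    using that eq1[of t] by (auto simp: T_def r_def cone_monoid_dual)
  have r_class: "r t = r t'" if t: "t \<in> T" "t' \<in> T" and d: "t - t' \<in> dual_lattice L\<^sub>1" for t t'
  proof -
    have "t' \<in> ?S" using t(2) by (simp add: T_def)
    then obtain k :: nat where k: "k > 0" "of_nat k *\<^sub>R t' \<in> ?S1" by (rule multiple_in_cone_monoid)
    \<comment> \<open>Adding \<open>(k - 1) t'\<close> to both \<open>t\<close> and \<open>t'\<close> moves them into \<open>S\<^sub>1\<close>, where the ratio is 1.\<close>
    have e: "t + of_nat (k - 1) *\<^sub>R t' = (t - t') + of_nat k *\<^sub>R t'"
      using k(1) by (cases k) (simp_all add: scaleR_add_left)
    have k1: "of_nat k *\<^sub>R t' \<in> dual_lattice L\<^sub>1" using k(2) by (simp add: cone_monoid_def)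
    have "t + of_nat (k - 1) *\<^sub>R t' \<in> dual_lattice L\<^sub>1"
      unfolding e by (rule dual_lattice_add[OF d k1])
    then have "r (t + of_nat (k - 1) *\<^sub>R t') = 1"
      by (rule r_trivial[OF T_add[OF t(1) T_scale[OF t(2)]]])
    then have "r t * r t' ^ (k - 1) = 1" by (simp add: r_add[OF t(1) T_scale[OF t(2)]] r_scale[OF t(2)])
    moreover have "r t' * r t' ^ (k - 1) = 1"
      using r_trivial[OF T_scale[OF t(2)] k1] k(1) by (simp add: r_scale[OF t(2)] flip: power_Suc)
    ultimately show ?thesis using r_nz[OF t(2)] by (metis mult_right_cancel power_not_zero)
  qed
  \<comment> \<open>The ratio, extended to the group generated by \<open>T\<close> and \<open>L\<^sub>1\<^sup>*\<close> by the value 1 on \<open>L\<^sub>1\<^sup>*\<close>.\<close>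
  define \<Gamma> where "\<Gamma> = {(t - t' + u, r t / r t') | t t' u. t \<in> T \<and> t' \<in> T \<and> u \<in> dual_lattice L\<^sub>1}"
  have mem: "t \<in> T \<Longrightarrow> t' \<in> T \<Longrightarrow> u \<in> dual_lattice L\<^sub>1 \<Longrightarrow> a = t - t' + u \<Longrightarrow> c = r t / r t' \<Longrightarrow> (a, c) \<in> \<Gamma>"
    for t t' u a c unfolding \<Gamma>_def by blast
  have "character_graph \<Gamma>"
    unfolding character_graph_def
  proof (intro conjI allI impI)
    show "(0, 1) \<in> \<Gamma>" using mem[OF T0 T0 dual_lattice_zero, of 0 1] r0 by simp
  next
    fix a c a' c' assume "(a, c) \<in> \<Gamma>" "(a', c') \<in> \<Gamma>"
    then obtain t s u t' s' u' where *: "t \<in> T" "s \<in> T" "u \<in> dual_lattice L\<^sub>1"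
        "t' \<in> T" "s' \<in> T" "u' \<in> dual_lattice L\<^sub>1"
        "a = t - s + u" "c = r t / r s" "a' = t' - s' + u'" "c' = r t' / r s'"
      unfolding \<Gamma>_def by blast
    show "(a - a', c / c') \<in> \<Gamma>"
      by (rule mem[OF T_add[OF *(1,5)] T_add[OF *(2,4)] dual_lattice_diff[OF *(3,6)]])
         (use * in \<open>auto simp: r_add\<close>)
  next
    fix c assume "(0, c) \<in> \<Gamma>"
    then obtain t s u where *: "t \<in> T" "s \<in> T" "u \<in> dual_lattice L\<^sub>1" "0 = t - s + u" "c = r t / r s"
      unfolding \<Gamma>_def by blast
    have "s - t = u" using *(4) by (simp add: algebra_simps)
    then have "r s = r t" using r_class[OF *(2,1)] *(3) by simp
    then show "c = 1" using *(5) r_nz[OF *(1)] by simp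
  qed
  moreover have "fst ` \<Gamma> \<subseteq> dual_lattice L"
    using dual_lattice_antimono[OF subset]
    by (auto simp: \<Gamma>_def T_def cone_monoid_def intro!: dual_lattice_diff dual_lattice_add)
  ultimately obtain l where l: "linear l" "\<And>a c. (a, c) \<in> \<Gamma> \<Longrightarrow> c = exp (l a)"
    using character_graph_dual[of \<Gamma>] by blast
  have l_r: "r t = exp (l t)" if "t \<in> T" for t
    using l(2)[OF mem[OF that T0 dual_lattice_zero refl refl]] r0 by simp
  have l_1: "exp (l u) = 1" if "u \<in> dual_lattice L\<^sub>1" for u
    using l(2)[OF mem[OF T0 T0 that refl refl]] r0 by simp
  have Re_l: "Re (l v) = 0" for v
  proof -
    obtain B where B: "independent B" "span B = UNIV" "dual_lattice L\<^sub>1 = int_span B"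
      using full_lattice_dual[OF full] unfolding full_lattice_def by blast
    have "b \<in> int_span B" if "b \<in> B" for b by (rule int_span_base[OF that])
    then show ?thesis using exp_linear_trivial_imp_Re_zero[OF l(1) B(2)] l_1 B(3) by blast
  qed
  define n where "n = (\<Sum>i\<in>Basis. (Im (l i) / (2 * pi)) *\<^sub>R i)"
  have l_n: "exp (l m) = cis (2 * pi * (m \<bullet> n))" for m
  proof -
    have "l m = l (\<Sum>i\<in>Basis. (m \<bullet> i) *\<^sub>R i)" by (simp add: euclidean_representation)
    also have "\<dots> = (\<Sum>i\<in>Basis. (m \<bullet> i) *\<^sub>R l i)"
      by (simp add: linear_sum[OF l(1)] linear_scale[OF l(1)])
    finally have "Im (l m) = (\<Sum>i\<in>Basis. (m \<bullet> i) * Im (l i))" by (metis (no_types, lifting) Im_sum scaleR_complex.simps(2) sum.cong)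
    also have "\<dots> = 2 * pi * (m \<bullet> n)"
      by (simp add: n_def inner_sum_right sum_distrib_left mult_ac)
    finally show ?thesis using Re_l[of m] by (simp add: exp_eq_polar)
  qed
  have "n \<in> dual_lattice (dual_lattice L\<^sub>1)"
    using l_1 by (auto simp: l_n cis_2pi_eq_1_iff dual_lattice_def inner_commute[of n])
  then have "n \<in> L\<^sub>1" by (simp add: dual_dual_lattice[OF full])
  moreover have "x' = translate L \<sigma> n x"
  proof (rule affine_chart_eqI[OF x' chart_act_affine_chart[OF x]])
    fix m assume m: "m \<in> ?S"
    show "x' m = translate L \<sigma> n x m"
    proof (cases "x m = 0")
      case True
      then show ?thesis using zero_iff[OF m] m by (simp add: translate_apply)
    next
      case False
      then have "r m = cis (2 * pi * (m \<bullet> n))" using l_r[of m] l_n[of m] m by (simp add: T_def)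
      then show ?thesis using False m by (simp add: r_def translate_apply field_simps)
    qed
  qed
  ultimately show thesis by (rule that)
qed

end

section \<open>Descent of polynomial relations and of open sets\<close>
lemma coordinate_ring_monomial:
  assumes "m \<in> cone_monoid L \<sigma>"
  shows "(\<lambda>x. c * x m) \<in> coordinate_ring L \<sigma>"
  unfolding coordinate_ring_def mem_Collect_eq
  by (rule exI[of _ "{m}"], rule exI[of _ "\<lambda>_. c"]) (use assms in simp)

lemma coordinate_ring_pair:
  assumes "a \<in> coordinate_ring L \<sigma>" "b \<in> coordinate_ring L \<sigma>"
  obtains A c d where "finite A" "A \<subseteq> cone_monoid L \<sigma>"
    "a = (\<lambda>x. \<Sum>m\<in>A. c m * x m)" "b = (\<lambda>x. \<Sum>m\<in>A. d m * x m)"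
proof -
  obtain A c where A: "finite A" "A \<subseteq> cone_monoid L \<sigma>" "a = (\<lambda>x. \<Sum>m\<in>A. c m * x m)"
    using assms(1) unfolding coordinate_ring_def by blast
  obtain B d where B: "finite B" "B \<subseteq> cone_monoid L \<sigma>" "b = (\<lambda>x. \<Sum>m\<in>B. d m * x m)"
    using assms(2) unfolding coordinate_ring_def by blast
  have ext: "(\<Sum>m\<in>C. e m * x m) = (\<Sum>m\<in>A \<union> B. (if m \<in> C then e m else 0) * x m)"
    if "C \<subseteq> A \<union> B" for C and e x :: "'a \<Rightarrow> complex"
    using that A(1) B(1) by (intro sum.mono_neutral_cong_left) auto
  show thesis
    by (rule that[of "A \<union> B" "\<lambda>m. if m \<in> A then c m else 0" "\<lambda>m. if m \<in> B then d m else 0"])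
       (use A B ext[of A c] ext[of B d] in auto)
qed

lemma coordinate_ring_add:
  assumes "a \<in> coordinate_ring L \<sigma>" "b \<in> coordinate_ring L \<sigma>"
  shows "(\<lambda>x. a x + b x) \<in> coordinate_ring L \<sigma>"
proof -
  obtain A c d where A: "finite A" "A \<subseteq> cone_monoid L \<sigma>"
    "a = (\<lambda>x. \<Sum>m\<in>A. c m * x m)" "b = (\<lambda>x. \<Sum>m\<in>A. d m * x m)"
    using assms by (rule coordinate_ring_pair)
  then have "(\<lambda>x. a x + b x) = (\<lambda>x. \<Sum>m\<in>A. (c m + d m) * x m)"
    by (simp add: sum.distrib distrib_right)
  with A(1,2) show ?thesis
    unfolding coordinate_ring_def mem_Collect_eq by (intro exI[of _ A] exI[of _ "\<lambda>m. c m + d m"]) simp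
qed

lemma coordinate_ring_sum:
  assumes "\<And>i. i \<in> I \<Longrightarrow> f i \<in> coordinate_ring L \<sigma>"
  shows "(\<lambda>x. \<Sum>i\<in>I. f i x) \<in> coordinate_ring L \<sigma>"
proof -
  have zero: "(\<lambda>x. 0) \<in> coordinate_ring L \<sigma>"
    using coordinate_ring_monomial[OF zero_in_cone_monoid, of 0] by simp
  show ?thesis
    using assms by (induction I rule: infinite_finite_induct) (simp_all add: zero coordinate_ring_add)
qed

lemma coordinate_ring_mult:
  assumes "a \<in> coordinate_ring L \<sigma>" "b \<in> coordinate_ring L \<sigma>"
  obtains d where "d \<in> coordinate_ring L \<sigma>" "\<And>x. x \<in> affine_chart L \<sigma> \<Longrightarrow> d x = a x * b x"
proof -
  obtain A c d where A: "finite A" "A \<subseteq> cone_monoid L \<sigma>"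
    "a = (\<lambda>x. \<Sum>m\<in>A. c m * x m)" "b = (\<lambda>x. \<Sum>m\<in>A. d m * x m)"
    using assms by (rule coordinate_ring_pair)
  show thesis
  proof (rule that)
    show "(\<lambda>x. \<Sum>m\<in>A. \<Sum>m'\<in>A. (c m * d m') * x (m + m')) \<in> coordinate_ring L \<sigma>"
      using A(2) by (intro coordinate_ring_sum coordinate_ring_monomial cone_monoid_add) auto
    show "(\<Sum>m\<in>A. \<Sum>m'\<in>A. (c m * d m') * x (m + m')) = a x * b x" if "x \<in> affine_chart L \<sigma>" for x
      using A(2) affine_chart_add[OF that]
      by (auto simp: A(3,4) sum_product mult_ac subset_iff intro!: sum.cong)
  qed
qed

text \<open>
  Nonvanishing loci of coordinate functions are closed under intersection, so they form a basis.
\<close>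

lemma openin_chart_topology:
  "openin (chart_topology L \<sigma>) W \<longleftrightarrow> W \<subseteq> affine_chart L \<sigma> \<and>
     (\<forall>x\<in>W. \<exists>a\<in>coordinate_ring L \<sigma>. a x \<noteq> 0 \<and> (\<forall>z\<in>affine_chart L \<sigma>. a z \<noteq> 0 \<longrightarrow> z \<in> W))"
proof
  assume "openin (chart_topology L \<sigma>) W"
  then have "generate_topology_on {{x \<in> affine_chart L \<sigma>. a x \<noteq> 0} | a. a \<in> coordinate_ring L \<sigma>} W"
    by (simp add: chart_topology_def openin_topology_generated_by_iff)
  then show "W \<subseteq> affine_chart L \<sigma> \<and>
      (\<forall>x\<in>W. \<exists>a\<in>coordinate_ring L \<sigma>. a x \<noteq> 0 \<and> (\<forall>z\<in>affine_chart L \<sigma>. a z \<noteq> 0 \<longrightarrow> z \<in> W))"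
  proof induction
    case (Int V W)
    have "\<exists>d\<in>coordinate_ring L \<sigma>. d x \<noteq> 0 \<and> (\<forall>z\<in>affine_chart L \<sigma>. d z \<noteq> 0 \<longrightarrow> z \<in> V \<inter> W)"
      if x: "x \<in> V \<inter> W" for x
    proof -
      obtain a b where a: "a \<in> coordinate_ring L \<sigma>" "a x \<noteq> 0" "\<forall>z\<in>affine_chart L \<sigma>. a z \<noteq> 0 \<longrightarrow> z \<in> V"
        and b: "b \<in> coordinate_ring L \<sigma>" "b x \<noteq> 0" "\<forall>z\<in>affine_chart L \<sigma>. b z \<noteq> 0 \<longrightarrow> z \<in> W"
        using Int.IH x by blast
      obtain d where d: "d \<in> coordinate_ring L \<sigma>" "\<And>x. x \<in> affine_chart L \<sigma> \<Longrightarrow> d x = a x * b x"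
        using coordinate_ring_mult[OF a(1) b(1)] by blast
      have "x \<in> affine_chart L \<sigma>" using Int.IH x by blast
      then show ?thesis using a b d by (intro bexI[OF _ d(1)]) auto
    qed
    then show ?case using Int.IH by blast
  next
    case (UN K)
    show ?case
    proof (intro conjI ballI)
      show "\<Union>K \<subseteq> affine_chart L \<sigma>" using UN.IH by blast
    next
      fix x assume "x \<in> \<Union>K"
      then obtain k where k: "k \<in> K" "x \<in> k" by blast
      then obtain a where "a \<in> coordinate_ring L \<sigma>" "a x \<noteq> 0" "\<forall>z\<in>affine_chart L \<sigma>. a z \<noteq> 0 \<longrightarrow> z \<in> k"
        using bspec[OF conjunct2[OF UN.IH[OF k(1)]] k(2)] by blast
      with k(1) show "\<exists>a\<in>coordinate_ring L \<sigma>. a x \<noteq> 0 \<and> (\<forall>z\<in>affine_chart L \<sigma>. a z \<noteq> 0 \<longrightarrow> z \<in> \<Union>K)"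
        by blast
    qed
  qed auto
next
  assume W: "W \<subseteq> affine_chart L \<sigma> \<and>
     (\<forall>x\<in>W. \<exists>a\<in>coordinate_ring L \<sigma>. a x \<noteq> 0 \<and> (\<forall>z\<in>affine_chart L \<sigma>. a z \<noteq> 0 \<longrightarrow> z \<in> W))"
  show "openin (chart_topology L \<sigma>) W"
  proof (subst openin_subopen, intro ballI)
    fix x assume x: "x \<in> W"
    with W obtain a where a: "a \<in> coordinate_ring L \<sigma>" "a x \<noteq> 0"
      "\<forall>z\<in>affine_chart L \<sigma>. a z \<noteq> 0 \<longrightarrow> z \<in> W" by blast
    have "openin (chart_topology L \<sigma>) {x \<in> affine_chart L \<sigma>. a x \<noteq> 0}"
      unfolding chart_topology_def using a(1) by (intro topology_generated_by_Basis) blast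
    then show "\<exists>T. openin (chart_topology L \<sigma>) T \<and> x \<in> T \<and> T \<subseteq> W"
      using a x W by (intro exI[of _ "{x \<in> affine_chart L \<sigma>. a x \<noteq> 0}"]) auto
  qed
qed

context lattice_inclusion
begin

text \<open>
  Linear independence of the characters \<open>n \<mapsto> exp (2 \<pi> \<i> \<langle>m, n\<rangle>)\<close> of \<open>L\<^sub>1\<close>, of which exactly those with \<open>m\<close> in
  \<open>L\<^sub>1\<^sup>*\<close> are trivial. Dedekind's argument removes the nontrivial ones one at a time: subtracting \<open>w\<close> times
  the sum from its translate by \<open>k\<close> cancels the term in which translation by \<open>k\<close> is multiplication by \<open>w\<close>,
  and multiplies the constant part by \<open>1 - w \<noteq> 0\<close>.
\<close>

lemma character_sum_dual_part:
  fixes c :: "'i \<Rightarrow> complex"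
  assumes "finite I" "\<And>n. n \<in> L\<^sub>1 \<Longrightarrow> (\<Sum>i\<in>I. c i * cis (2 * pi * (f i \<bullet> n))) = 0"
  shows "(\<Sum>i | i \<in> I \<and> f i \<in> dual_lattice L\<^sub>1. c i) = 0"
proof -
  have elim: "C = 0" if "finite E" "\<And>i. i \<in> E \<Longrightarrow> f i \<notin> dual_lattice L\<^sub>1"
      "\<And>n. n \<in> L\<^sub>1 \<Longrightarrow> (\<Sum>i\<in>E. c i * cis (2 * pi * (f i \<bullet> n))) + C = 0" for E c C
    using that
  proof (induction E arbitrary: c C)
    case empty
    then show ?case using L1_closed(1) by force
  next
    case (insert j E)
    obtain k where k: "k \<in> L\<^sub>1" "f j \<bullet> k \<notin> \<int>"
      using insert.prems(1)[of j] by (auto simp: dual_lattice_def)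
    define e where "e i n = cis (2 * pi * (f i \<bullet> n))" for i n
    define w where "w = e j k"
    have w: "w \<noteq> 1" using k(2) by (simp add: w_def e_def cis_2pi_eq_1_iff)
    have "C * (1 - w) = 0"
    proof (rule insert.IH[of "\<lambda>i. c i * (e i k - w)"])
      fix n assume n: "n \<in> L\<^sub>1"
      have add: "e i (k + n) = e i k * e i n" for i
        by (simp add: e_def inner_add_right distrib_left cis_mult)
      have "(\<Sum>i\<in>E. c i * (e i k - w) * e i n) + C * (1 - w)
          = ((\<Sum>i\<in>E. c i * e i (k + n)) + c j * e j (k + n) + C)
            - w * ((\<Sum>i\<in>E. c i * e i n) + c j * e j n + C)"
        by (simp add: add w_def sum_distrib_left sum_subtractf algebra_simps)
      also have "\<dots> = 0"
        using insert.prems(2)[of n] insert.prems(2)[of "k + n"] n k(1) L1_closed insert.hyps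
        by (simp add: add_ac flip: e_def)
      finally show "(\<Sum>i\<in>E. c i * (e i k - w) * cis (2 * pi * (f i \<bullet> n))) + C * (1 - w) = 0"
        by (simp add: e_def)
    qed (use insert.prems(1) in auto)
    with w show ?case by simp
  qed
  let ?F = "{i \<in> I. f i \<in> dual_lattice L\<^sub>1}"
  show ?thesis
  proof (rule elim[of "I - ?F"])
    fix n assume n: "n \<in> L\<^sub>1"
    have "(\<Sum>i\<in>?F. c i) = (\<Sum>i\<in>?F. c i * cis (2 * pi * (f i \<bullet> n)))"
      by (rule sum.cong) (use n in \<open>auto simp: dual_lattice_def cis_2pi_eq_1_iff\<close>)
    then show "(\<Sum>i\<in>I - ?F. c i * cis (2 * pi * (f i \<bullet> n))) + (\<Sum>i\<in>?F. c i) = 0"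
      using assms(2)[OF n] sum.subset_diff[of ?F I "\<lambda>i. c i * cis (2 * pi * (f i \<bullet> n))"] assms(1)
      by simp
  qed (use assms(1) in auto)
qed

lemma coordinate_ring_restrict:
  assumes "a \<in> coordinate_ring L\<^sub>1 \<sigma>"
  shows "a \<in> coordinate_ring L \<sigma>" "a (restrict x (cone_monoid L\<^sub>1 \<sigma>)) = a x"
proof -
  obtain A c where A: "finite A" "A \<subseteq> cone_monoid L\<^sub>1 \<sigma>" "a = (\<lambda>x. \<Sum>m\<in>A. c m * x m)"
    using assms unfolding coordinate_ring_def by blast
  show "a \<in> coordinate_ring L \<sigma>" using A cone_monoid_subset[of \<sigma>] unfolding coordinate_ring_def by blast
  show "a (restrict x (cone_monoid L\<^sub>1 \<sigma>)) = a x"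
    unfolding A(3) by (rule sum.cong) (use A(2) in auto)
qed

text \<open>
  A relation \<open>\<alpha> b = \<beta> a\<close> on the orbit of \<open>z\<close> holds separately for the parts of \<open>a\<close> and \<open>b\<close> whose exponents
  lie in a fixed class modulo \<open>L\<^sub>1\<^sup>*\<close>. Choose a class \<open>C\<close> whose part of \<open>b\<close> does not vanish at \<open>x\<close>, and in
  it an exponent \<open>m0\<close> with \<open>x m0 \<noteq> 0\<close>. If \<open>k m0\<close> is in \<open>L\<^sub>1\<^sup>*\<close>, multiplication by the monomial of
  \<open>p = (k - 1) m0\<close> moves the part for \<open>C\<close> into the smaller ring and does not vanish at \<open>x\<close>. The functions
  \<open>a1\<close> and \<open>b1\<close> do not depend on \<open>z\<close>, \<open>\<alpha>\<close> and \<open>\<beta>\<close>: with \<open>\<alpha> = f z\<close> and \<open>\<beta> = 1\<close> they represent an invariant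
  function \<open>f\<close> as a fraction, and with \<open>\<alpha> = 1\<close> and \<open>\<beta> = 0\<close> they show that the nonvanishing locus of \<open>b1\<close> is
  contained in the union of the translates of that of \<open>b\<close>.
\<close>

lemma invariant_relation_descends:
  assumes a: "a \<in> coordinate_ring L \<sigma>" and b: "b \<in> coordinate_ring L \<sigma>"
    and x: "x \<in> affine_chart L \<sigma>" "b x \<noteq> 0"
  shows "\<exists>a1\<in>coordinate_ring L\<^sub>1 \<sigma>. \<exists>b1\<in>coordinate_ring L\<^sub>1 \<sigma>. b1 x \<noteq> 0 \<and>
    (\<forall>z\<in>affine_chart L \<sigma>. \<forall>\<alpha> \<beta>.
       (\<forall>n\<in>L\<^sub>1. \<alpha> * b (translate L \<sigma> n z) = \<beta> * a (translate L \<sigma> n z)) \<longrightarrow>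
       \<alpha> * b1 z = \<beta> * a1 z)"
proof -
  obtain A c d where A: "finite A" "A \<subseteq> cone_monoid L \<sigma>"
    and a_eq: "a = (\<lambda>x. \<Sum>m\<in>A. c m * x m)" and b_eq: "b = (\<lambda>x. \<Sum>m\<in>A. d m * x m)"
    using a b by (rule coordinate_ring_pair)
  define q where "q m = {m'. m - m' \<in> dual_lattice L\<^sub>1}" for m
  have q_mem: "m - m' \<in> dual_lattice L\<^sub>1 \<Longrightarrow> m' - m \<in> dual_lattice L\<^sub>1" for m m'
    using dual_lattice_int_scale[of "m - m'" L\<^sub>1 "- 1"] by simp
  have q_eq: "q m = q m' \<longleftrightarrow> m - m' \<in> dual_lattice L\<^sub>1" for m m'
  proof
    assume "q m = q m'"
    moreover have "m' \<in> q m'" by (simp add: q_def dual_lattice_zero)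
    ultimately show "m - m' \<in> dual_lattice L\<^sub>1" by (simp add: q_def set_eq_iff)
  next
    assume mm: "m - m' \<in> dual_lattice L\<^sub>1"
    have "m - u \<in> dual_lattice L\<^sub>1 \<longleftrightarrow> m' - u \<in> dual_lattice L\<^sub>1" for u
      using dual_lattice_diff[of "m - u" L\<^sub>1 "m - m'"] dual_lattice_add[of "m' - u" L\<^sub>1 "m - m'"] mm
      by auto
    then show "q m = q m'" by (simp add: q_def)
  qed
  have "(\<Sum>C\<in>q ` A. \<Sum>m | m \<in> A \<and> q m = C. d m * x m) \<noteq> 0"
    using x(2) sum.image_gen[OF A(1), of "\<lambda>m. d m * x m" q] by (simp add: b_eq)
  then obtain C where C: "(\<Sum>m | m \<in> A \<and> q m = C. d m * x m) \<noteq> 0"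
    by (rule sum.not_neutral_contains_not_neutral)
  then obtain m0 where "m0 \<in> {m \<in> A. q m = C}" "d m0 * x m0 \<noteq> 0"
    by (rule sum.not_neutral_contains_not_neutral)
  then have m0: "m0 \<in> A" "q m0 = C" "x m0 \<noteq> 0" by auto
  have m0S: "m0 \<in> cone_monoid L \<sigma>" using m0(1) A(2) by blast
  obtain k :: nat where k: "k > 0" "of_nat k *\<^sub>R m0 \<in> cone_monoid L\<^sub>1 \<sigma>"
    by (rule multiple_in_cone_monoid[OF m0S])
  define p where "p = of_nat (k - 1) *\<^sub>R m0"
  have p: "p \<in> cone_monoid L \<sigma>" unfolding p_def by (rule cone_monoid_nat_scale[OF m0S])
  have xp: "x p \<noteq> 0" using m0(3) by (simp add: p_def affine_chart_nat_scale[OF x(1) m0S])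
  have p_class: "m + p \<in> dual_lattice L\<^sub>1 \<longleftrightarrow> q m = C" for m
  proof -
    have e: "m + p = (m - m0) + of_nat k *\<^sub>R m0"
      using k(1) by (cases k) (simp_all add: p_def scaleR_add_left)
    have "of_nat k *\<^sub>R m0 \<in> dual_lattice L\<^sub>1" using k(2) by (simp add: cone_monoid_def)
    then have "m + p \<in> dual_lattice L\<^sub>1 \<longleftrightarrow> m - m0 \<in> dual_lattice L\<^sub>1"
      unfolding e using dual_lattice_add[of "m - m0" L\<^sub>1 "of_nat k *\<^sub>R m0"]
        dual_lattice_diff[of "(m - m0) + of_nat k *\<^sub>R m0" L\<^sub>1 "of_nat k *\<^sub>R m0"] by auto
    then show ?thesis using q_eq m0(2) by auto
  qed
  define part where "part e = (\<lambda>z. \<Sum>m | m \<in> A \<and> q m = C. e m * z (m + p))" for e :: "'a \<Rightarrow> complex"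
  have part_ring: "part e \<in> coordinate_ring L\<^sub>1 \<sigma>" for e
    unfolding part_def
  proof (intro coordinate_ring_sum coordinate_ring_monomial)
    fix m assume "m \<in> {m \<in> A. q m = C}"
    then show "m + p \<in> cone_monoid L\<^sub>1 \<sigma>"
      using A(2) p p_class by (intro cone_monoid_dual cone_monoid_add[where L = L]) auto
  qed
  have part_eq: "part e z = (\<Sum>m | m \<in> A \<and> q m = C. e m * z m) * z p" if "z \<in> affine_chart L \<sigma>" for e z
    unfolding part_def sum_distrib_right
    by (rule sum.cong) (use A(2) p affine_chart_add[OF that] in auto)
  show ?thesis
  proof (rule bexI[OF _ part_ring], rule bexI[OF _ part_ring], intro conjI ballI allI impI)
    show "part d x \<noteq> 0" using C xp by (simp add: part_eq[OF x(1)])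
  next
    fix z \<alpha> \<beta>
    assume z: "z \<in> affine_chart L \<sigma>"
      and rel: "\<forall>n\<in>L\<^sub>1. \<alpha> * b (translate L \<sigma> n z) = \<beta> * a (translate L \<sigma> n z)"
    have "(\<Sum>m | m \<in> A \<and> m + p \<in> dual_lattice L\<^sub>1. (\<alpha> * d m - \<beta> * c m) * z m) = 0"
    proof (rule character_sum_dual_part[OF A(1)])
      fix n assume n: "n \<in> L\<^sub>1"
      have tr: "e (translate L \<sigma> n z) = (\<Sum>m\<in>A. h m * (cis (2 * pi * (m \<bullet> n)) * z m))"
        if "e = (\<lambda>x. \<Sum>m\<in>A. h m * x m)" for e h
        unfolding that by (rule sum.cong) (use A(2) in \<open>auto simp: translate_apply\<close>)
      have "(\<Sum>m\<in>A. (\<alpha> * d m - \<beta> * c m) * z m * cis (2 * pi * ((m + p) \<bullet> n)))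
          = cis (2 * pi * (p \<bullet> n)) * (\<alpha> * b (translate L \<sigma> n z) - \<beta> * a (translate L \<sigma> n z))"
        unfolding tr[OF a_eq] tr[OF b_eq]
        by (simp add: inner_add_left distrib_left sum_distrib_left sum_subtractf algebra_simps
            flip: cis_mult)
      then show "(\<Sum>m\<in>A. (\<alpha> * d m - \<beta> * c m) * z m * cis (2 * pi * ((m + p) \<bullet> n))) = 0"
        using bspec[OF rel n] by simp
    qed
    then have "\<alpha> * (\<Sum>m | m \<in> A \<and> q m = C. d m * z m) = \<beta> * (\<Sum>m | m \<in> A \<and> q m = C. c m * z m)"
      by (simp add: p_class sum_distrib_left sum_subtractf algebra_simps)
    then show "\<alpha> * part d z = \<beta> * part c z" by (simp add: part_eq[OF z])
  qed
qed

lemma openin_chart_restrict_iff: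
  assumes "W \<subseteq> affine_chart L\<^sub>1 \<sigma>"
  shows "openin (chart_topology L \<sigma>) {x \<in> affine_chart L \<sigma>. restrict x (cone_monoid L\<^sub>1 \<sigma>) \<in> W} \<longleftrightarrow>
    openin (chart_topology L\<^sub>1 \<sigma>) W" (is "openin _ ?W \<longleftrightarrow> _")
proof
  assume W: "openin (chart_topology L\<^sub>1 \<sigma>) W"
  show "openin (chart_topology L \<sigma>) ?W"
    unfolding openin_chart_topology
  proof (intro conjI ballI)
    fix x assume "x \<in> ?W"
    then obtain a where a: "a \<in> coordinate_ring L\<^sub>1 \<sigma>" "a (restrict x (cone_monoid L\<^sub>1 \<sigma>)) \<noteq> 0"
        "\<forall>z\<in>affine_chart L\<^sub>1 \<sigma>. a z \<noteq> 0 \<longrightarrow> z \<in> W"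
      using W unfolding openin_chart_topology by blast
    then show "\<exists>a\<in>coordinate_ring L \<sigma>. a x \<noteq> 0 \<and> (\<forall>z\<in>affine_chart L \<sigma>. a z \<noteq> 0 \<longrightarrow> z \<in> ?W)"
      using coordinate_ring_restrict[OF a(1)] restrict_chart[of _ \<sigma>] by (intro bexI[of _ a]) auto
  qed auto
next
  assume W: "openin (chart_topology L \<sigma>) ?W"
  show "openin (chart_topology L\<^sub>1 \<sigma>) W"
    unfolding openin_chart_topology
  proof (intro conjI ballI assms)
    fix y assume y: "y \<in> W"
    then obtain x where x: "x \<in> affine_chart L \<sigma>" "restrict x (cone_monoid L\<^sub>1 \<sigma>) = y"
      using extend_chart_point assms by blast
    then have "x \<in> ?W" using y by simp
    then obtain b where b: "b \<in> coordinate_ring L \<sigma>" "b x \<noteq> 0"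
        "\<forall>z\<in>affine_chart L \<sigma>. b z \<noteq> 0 \<longrightarrow> z \<in> ?W"
      using bspec[OF conjunct2[OF iffD1[OF openin_chart_topology W]]] by blast
    obtain a1 b1 where b1: "b1 \<in> coordinate_ring L\<^sub>1 \<sigma>" "b1 x \<noteq> 0"
      "\<forall>z\<in>affine_chart L \<sigma>. \<forall>\<alpha> \<beta>.
         (\<forall>n\<in>L\<^sub>1. \<alpha> * b (translate L \<sigma> n z) = \<beta> * b (translate L \<sigma> n z)) \<longrightarrow>
         \<alpha> * b1 z = \<beta> * a1 z"
      using invariant_relation_descends[OF b(1) b(1) x(1) b(2)] by (elim bexE conjE)
    show "\<exists>a\<in>coordinate_ring L\<^sub>1 \<sigma>. a y \<noteq> 0 \<and> (\<forall>w\<in>affine_chart L\<^sub>1 \<sigma>. a w \<noteq> 0 \<longrightarrow> w \<in> W)"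
    proof (intro bexI[OF _ b1(1)] conjI ballI impI)
      show "b1 y \<noteq> 0" using b1(2) coordinate_ring_restrict(2)[OF b1(1), of x] x(2) by simp
    next
      fix w assume w: "w \<in> affine_chart L\<^sub>1 \<sigma>" "b1 w \<noteq> 0"
      obtain z where z: "z \<in> affine_chart L \<sigma>" "restrict z (cone_monoid L\<^sub>1 \<sigma>) = w"
        using extend_chart_point[OF w(1)] by blast
      have "b1 z \<noteq> 0" using w(2) coordinate_ring_restrict(2)[OF b1(1), of z] z(2) by simp
      then obtain n where "n \<in> L\<^sub>1" "b (translate L \<sigma> n z) \<noteq> 0"
        using spec[OF spec[OF bspec[OF b1(3) z(1)], of 1], of 0] by auto
      then show "w \<in> W"
        using bspec[OF b(3) chart_act_affine_chart[OF z(1)], of n] restrict_translate[of n \<sigma> z] z(2) by simp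
    qed
  qed
qed

end

section \<open>The quotient of a toric variety by an overlattice\<close>
lemma points_quotient_space: "points (quotient_space X G) = orbit_of G ` points X"
proof -
  have "{p \<in> points X. orbit_of G p \<in> orbit_of G ` points X} = points X" by blast
  then have "openin (zariski (quotient_space X G)) (orbit_of G ` points X)"
    by (simp add: openin_quotient_space)
  then show ?thesis
    by (meson openin_quotient_space openin_subset openin_topspace subset_antisym)
qed

lemma fun_space_iso_quotient:
  assumes surj: "\<Psi> ` points X = points Y"
    and orbits: "\<And>p p'. p \<in> points X \<Longrightarrow> p' \<in> points X \<Longrightarrow> orbit_of G p = orbit_of G p' \<longleftrightarrow> \<Psi> p = \<Psi> p'"
    and opens: "\<And>V. V \<subseteq> points Y \<Longrightarrow>
        openin (zariski X) {p \<in> points X. \<Psi> p \<in> V} \<longleftrightarrow> openin (zariski Y) V"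
    and regular: "\<And>V f h. openin (zariski Y) V \<Longrightarrow> (\<And>p. p \<in> points X \<Longrightarrow> h p = f (\<Psi> p)) \<Longrightarrow>
        f \<in> regular Y V \<longleftrightarrow> h \<in> regular X {p \<in> points X. \<Psi> p \<in> V}"
  shows "fun_space_iso (quotient_space X G) Y"
proof -
  define \<phi> where "\<phi> C = \<Psi> (SOME p. p \<in> points X \<and> orbit_of G p = C)" for C
  have \<phi>: "\<phi> (orbit_of G p) = \<Psi> p" if "p \<in> points X" for p
  proof -
    have "\<exists>p'. p' \<in> points X \<and> orbit_of G p' = orbit_of G p" using that by blast
    then have "(SOME p'. p' \<in> points X \<and> orbit_of G p' = orbit_of G p) \<in> points X \<and>
        orbit_of G (SOME p'. p' \<in> points X \<and> orbit_of G p' = orbit_of G p) = orbit_of G p"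
      by (rule someI_ex)
    then show ?thesis using orbits[OF _ that] unfolding \<phi>_def by blast
  qed
  have pre: "{p \<in> points X. orbit_of G p \<in> {C \<in> orbit_of G ` points X. \<phi> C \<in> V}} = {p \<in> points X. \<Psi> p \<in> V}"
    for V using \<phi> by auto
  have "homeomorphic_map (zariski (quotient_space X G)) (zariski Y) \<phi>"
    unfolding homeomorphic_map_def quotient_map_def points_quotient_space
  proof (intro conjI allI impI)
    show "\<phi> ` orbit_of G ` points X = points Y" using \<phi> surj by (auto simp: image_image)
    show "inj_on \<phi> (orbit_of G ` points X)" using \<phi> orbits by (auto simp: inj_on_def)
  next
    fix V assume "V \<subseteq> points Y"
    from opens[OF this] pre[of V]
    show "openin (zariski (quotient_space X G)) {C \<in> orbit_of G ` points X. \<phi> C \<in> V} = openin (zariski Y) V"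
      by (auto simp: openin_quotient_space)
  qed
  moreover have "f \<in> fun_space.regular Y V \<longleftrightarrow>
      f \<circ> \<phi> \<in> fun_space.regular (quotient_space X G) {C \<in> points (quotient_space X G). \<phi> C \<in> V}"
    if V: "openin (zariski Y) V" for V f
  proof -
    have "f \<circ> \<phi> \<in> fun_space.regular (quotient_space X G) {C \<in> points (quotient_space X G). \<phi> C \<in> V} \<longleftrightarrow>
        f \<circ> \<phi> \<circ> orbit_of G \<in> fun_space.regular X {p \<in> points X. \<Psi> p \<in> V}"
      unfolding points_quotient_space using pre[of V] by (simp add: quotient_space_def)
    then show ?thesis using regular[OF V, of "f \<circ> \<phi> \<circ> orbit_of G" f] \<phi> by simp
  qed
  ultimately show ?thesis unfolding fun_space_iso_def by blast
qed

lemma chart_map_eq_iff: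
  "chart_map L \<Sigma> \<sigma> x = chart_map L \<Sigma> \<sigma>' x' \<longleftrightarrow> equivclp (glue L \<Sigma>) (\<sigma>, x) (\<sigma>', x')"
proof
  assume "chart_map L \<Sigma> \<sigma> x = chart_map L \<Sigma> \<sigma>' x'"
  moreover have "(\<sigma>', x') \<in> chart_map L \<Sigma> \<sigma>' x'" by (simp add: chart_map_def)
  ultimately have "(\<sigma>', x') \<in> chart_map L \<Sigma> \<sigma> x" by simp
  then show "equivclp (glue L \<Sigma>) (\<sigma>, x) (\<sigma>', x')" by (simp add: chart_map_def)
next
  assume eq: "equivclp (glue L \<Sigma>) (\<sigma>, x) (\<sigma>', x')"
  show "chart_map L \<Sigma> \<sigma> x = chart_map L \<Sigma> \<sigma>' x'"
    unfolding chart_map_def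
    using equivclp_trans[OF eq] equivclp_trans[OF equivclp_sym[OF eq]] by (intro Collect_cong iffI)
qed

lemma torus_act_add: "torus_act L n (torus_act L n' p) = torus_act L (n + n') p"
  by (simp add: torus_act_def image_image chart_act_add)

lemma mem_regular_toric_variety:
  "f \<in> fun_space.regular (toric_variety L \<Sigma>) V \<longleftrightarrow>
    (\<forall>\<sigma>\<in>\<Sigma>. \<forall>x\<in>chart_preimage L \<Sigma> \<sigma> V.
       \<exists>W. openin (chart_topology L \<sigma>) W \<and> x \<in> W \<and> W \<subseteq> chart_preimage L \<Sigma> \<sigma> V \<and>
         (\<exists>a\<in>coordinate_ring L \<sigma>. \<exists>b\<in>coordinate_ring L \<sigma>.
            \<forall>z\<in>W. b z \<noteq> 0 \<and> f (chart_map L \<Sigma> \<sigma> z) = a z / b z))"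
  by (simp add: toric_variety_def)

text \<open>
  The assumption says that \<open>\<tau>\<close> is the face of \<open>\<sigma>\<close> cut out by an element \<open>m0\<close> of \<open>L\<^sub>1\<^sup>*\<close>, in the form in
  which it is used: \<open>S\<^sub>\<tau>\<close> arises from \<open>S\<^sub>\<sigma>\<close> by inverting \<open>m0\<close>.
\<close>

locale fan_in_lattices = lattice_inclusion L L\<^sub>1 for L L\<^sub>1 :: "'a::euclidean_space set" +
  fixes \<Sigma> :: "'a set set"
  assumes separation: "\<And>\<tau> \<sigma>. \<tau> \<in> \<Sigma> \<Longrightarrow> \<sigma> \<in> \<Sigma> \<Longrightarrow> \<tau> face_of \<sigma> \<Longrightarrow>
    \<exists>m0\<in>cone_monoid L\<^sub>1 \<sigma>. - m0 \<in> cone_monoid L\<^sub>1 \<tau> \<and>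
      (\<forall>m\<in>cone_monoid L \<tau>. \<exists>k::nat. m + of_nat k *\<^sub>R m0 \<in> dual_cone \<sigma>)"
begin

text \<open>
  The chart of \<open>\<tau>\<close> consists of the points of the chart of \<open>\<sigma>\<close> that do not vanish at \<open>m0\<close>. As \<open>m0\<close> is in
  \<open>L\<^sub>1\<^sup>*\<close>, this can be tested after restriction to the smaller monoid.
\<close>

lemma extend_to_face_chart:
  assumes "\<tau> \<in> \<Sigma>" "\<sigma> \<in> \<Sigma>" and face: "\<tau> face_of \<sigma>"
    and x: "x \<in> affine_chart L \<sigma>" and y1: "y1 \<in> affine_chart L\<^sub>1 \<tau>"
    and eq: "restrict x (cone_monoid L\<^sub>1 \<sigma>) = restrict y1 (cone_monoid L\<^sub>1 \<sigma>)"
  obtains y where "y \<in> affine_chart L \<tau>" "restrict y (cone_monoid L \<sigma>) = x"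
    "restrict y (cone_monoid L\<^sub>1 \<tau>) = y1"
proof -
  obtain m0 where m0: "m0 \<in> cone_monoid L\<^sub>1 \<sigma>" "- m0 \<in> cone_monoid L\<^sub>1 \<tau>"
    and shift: "\<And>m. m \<in> cone_monoid L \<tau> \<Longrightarrow> \<exists>k::nat. m + of_nat k *\<^sub>R m0 \<in> dual_cone \<sigma>"
    using separation[OF assms(1-3)] by blast
  have sub: "cone_monoid K \<sigma> \<subseteq> cone_monoid K \<tau>" for K
    by (rule cone_monoid_antimono[OF face_of_imp_subset[OF face]])
  have m0S: "m0 \<in> cone_monoid L \<sigma>" and m0T: "m0 \<in> cone_monoid L\<^sub>1 \<tau>" and m0LT: "m0 \<in> cone_monoid L \<tau>"
    using m0(1) cone_monoid_subset[of \<sigma>] cone_monoid_subset[of \<tau>] sub[of L\<^sub>1] by blast+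
  have xy: "x m = y1 m" if "m \<in> cone_monoid L\<^sub>1 \<sigma>" for m using fun_cong[OF eq, of m] that by simp
  have x_nz: "x m0 \<noteq> 0"
    using affine_chart_add[OF y1 m0T m0(2)] affine_chart_one[OF y1] xy[OF m0(1)] by auto
  have lift: "\<exists>k::nat. m + of_nat k *\<^sub>R m0 \<in> cone_monoid L \<sigma>" if m: "m \<in> cone_monoid L \<tau>" for m
  proof -
    obtain k :: nat where k: "m + of_nat k *\<^sub>R m0 \<in> dual_cone \<sigma>" using shift[OF m] by blast
    have "m + of_nat k *\<^sub>R m0 \<in> cone_monoid L \<tau>"
      by (rule cone_monoid_add[OF m cone_monoid_nat_scale[OF m0LT]])
    with k show ?thesis by (auto simp: cone_monoid_def)
  qed
  \<comment> \<open>By \<open>y_eq\<close>, every admissible exponent \<open>k\<close> gives the same value.\<close>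
  define y where "y = (\<lambda>m\<in>cone_monoid L \<tau>.
    let k = (SOME k::nat. m + of_nat k *\<^sub>R m0 \<in> cone_monoid L \<sigma>) in x (m + of_nat k *\<^sub>R m0) / x m0 ^ k)"
  have y_eq: "y m = x (m + of_nat k *\<^sub>R m0) / x m0 ^ k"
    if m: "m \<in> cone_monoid L \<tau>" and k: "m + of_nat k *\<^sub>R m0 \<in> cone_monoid L \<sigma>" for m k
  proof -
    define j where "j = (SOME k::nat. m + of_nat k *\<^sub>R m0 \<in> cone_monoid L \<sigma>)"
    have j: "m + of_nat j *\<^sub>R m0 \<in> cone_monoid L \<sigma>" unfolding j_def by (rule someI_ex[OF lift[OF m]])
    have "x (m + of_nat j *\<^sub>R m0) * x m0 ^ k = x (m + of_nat j *\<^sub>R m0 + of_nat k *\<^sub>R m0)"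
      by (simp add: affine_chart_add[OF x j cone_monoid_nat_scale[OF m0S]] affine_chart_nat_scale[OF x m0S])
    also have "\<dots> = x (m + of_nat k *\<^sub>R m0 + of_nat j *\<^sub>R m0)" by (simp add: add_ac)
    also have "\<dots> = x (m + of_nat k *\<^sub>R m0) * x m0 ^ j"
      by (simp add: affine_chart_add[OF x k cone_monoid_nat_scale[OF m0S]] affine_chart_nat_scale[OF x m0S])
    finally show ?thesis
      using x_nz m by (simp add: y_def Let_def field_simps flip: j_def)
  qed
  have y_S: "y m = x m" if "m \<in> cone_monoid L \<sigma>" for m
    using y_eq[of m 0] that sub[of L] by auto
  have y_S1: "y m = y1 m" if m: "m \<in> cone_monoid L\<^sub>1 \<tau>" for m
  proof -
    have mL: "m \<in> cone_monoid L \<tau>" using m cone_monoid_subset[of \<tau>] by blast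
    obtain k :: nat where k: "m + of_nat k *\<^sub>R m0 \<in> cone_monoid L \<sigma>" using lift[OF mL] by blast
    have "m + of_nat k *\<^sub>R m0 \<in> cone_monoid L\<^sub>1 \<tau>"
      by (rule cone_monoid_add[OF m cone_monoid_nat_scale[OF m0T]])
    then have k1: "m + of_nat k *\<^sub>R m0 \<in> cone_monoid L\<^sub>1 \<sigma>" using k by (simp add: cone_monoid_def)
    have "y m = y1 (m + of_nat k *\<^sub>R m0) / y1 m0 ^ k"
      using y_eq[OF mL k] xy[OF k1] xy[OF m0(1)] by simp
    also have "\<dots> = y1 m"
      using x_nz xy[OF m0(1)]
      by (simp add: affine_chart_add[OF y1 m cone_monoid_nat_scale[OF m0T]] affine_chart_nat_scale[OF y1 m0T])
    finally show ?thesis .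
  qed
  have y: "y \<in> affine_chart L \<tau>"
    unfolding affine_chart_def
  proof (intro CollectI conjI ballI)
    show "y \<in> extensional (cone_monoid L \<tau>)" by (simp add: y_def)
    show "y 0 = 1" using y_S[OF zero_in_cone_monoid] affine_chart_one[OF x] by simp
  next
    fix m m' assume m: "m \<in> cone_monoid L \<tau>" and m': "m' \<in> cone_monoid L \<tau>"
    obtain i where i: "m + of_nat i *\<^sub>R m0 \<in> cone_monoid L \<sigma>" using lift[OF m] by blast
    obtain j where j: "m' + of_nat j *\<^sub>R m0 \<in> cone_monoid L \<sigma>" using lift[OF m'] by blast
    have e: "(m + m') + of_nat (i + j) *\<^sub>R m0 = (m + of_nat i *\<^sub>R m0) + (m' + of_nat j *\<^sub>R m0)"
      by (simp add: scaleR_add_left)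
    have ij: "(m + m') + of_nat (i + j) *\<^sub>R m0 \<in> cone_monoid L \<sigma>"
      unfolding e by (rule cone_monoid_add[OF i j])
    show "y (m + m') = y m * y m'"
      unfolding y_eq[OF cone_monoid_add[OF m m'] ij] y_eq[OF m i] y_eq[OF m' j] e
        affine_chart_add[OF x i j] by (simp add: power_add)
  qed
  show thesis
  proof (rule that[OF y])
    show "restrict y (cone_monoid L \<sigma>) = x"
      by (rule affine_chart_eqI[OF restrict_affine_chart[OF y face_of_imp_subset[OF face]] x]) (simp add: y_S)
    show "restrict y (cone_monoid L\<^sub>1 \<tau>) = y1"
      by (rule affine_chart_eqI[OF restrict_chart[OF y] y1]) (simp add: y_S1)
  qed
qed

definition restrict_pair :: "'a set \<times> ('a \<Rightarrow> complex) \<Rightarrow> 'a set \<times> ('a \<Rightarrow> complex)" where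
  "restrict_pair p = (fst p, restrict (snd p) (cone_monoid L\<^sub>1 (fst p)))"

lemma equivclp_glue_restrict:
  assumes "equivclp (glue L \<Sigma>) p q"
  shows "equivclp (glue L\<^sub>1 \<Sigma>) (restrict_pair p) (restrict_pair q)"
proof -
  have step: "glue L\<^sub>1 \<Sigma> (restrict_pair p) (restrict_pair q)" if "glue L \<Sigma> p q" for p q
  proof -
    from that obtain \<tau> \<sigma> y where *: "\<tau> \<in> \<Sigma>" "\<sigma> \<in> \<Sigma>" "y \<in> affine_chart L \<tau>" "\<tau> face_of \<sigma>"
        "p = (\<tau>, y)" "q = (\<sigma>, restrict y (cone_monoid L \<sigma>))"
      unfolding glue_def by blast
    have "cone_monoid L\<^sub>1 \<sigma> \<inter> cone_monoid L \<sigma> = cone_monoid L\<^sub>1 \<tau> \<inter> cone_monoid L\<^sub>1 \<sigma>"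
      using cone_monoid_subset[of \<sigma>] cone_monoid_antimono[OF face_of_imp_subset[OF *(4)], of L\<^sub>1] by blast
    then have "restrict_pair q = (\<sigma>, restrict (restrict y (cone_monoid L\<^sub>1 \<tau>)) (cone_monoid L\<^sub>1 \<sigma>))"
      by (simp add: restrict_pair_def * Int_commute)
    then show ?thesis
      unfolding glue_def using * restrict_chart[OF *(3)] by (auto simp: restrict_pair_def)
  qed
  show ?thesis
    using assms by (induction rule: equivclp_induct) (simp, meson step equivclp_into_equivclp)
qed

text \<open>
  A step from \<open>\<tau>\<close> to \<open>\<sigma>\<close> lifts by restriction, a step back from \<open>\<sigma>\<close> to \<open>\<tau>\<close> by \<open>extend_to_face_chart\<close>.
\<close>

lemma equivclp_glue_lift:
  assumes "equivclp (glue L\<^sub>1 \<Sigma>) (restrict_pair (\<sigma>, x)) q" "x \<in> affine_chart L \<sigma>"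
  shows "\<exists>z\<in>affine_chart L (fst q). restrict_pair (fst q, z) = q \<and> equivclp (glue L \<Sigma>) (\<sigma>, x) (fst q, z)"
  using assms(1)
proof (induction rule: equivclp_induct)
  case base
  then show ?case using assms(2) by (intro bexI[of _ x]) (simp_all add: restrict_pair_def)
next
  case (step q r)
  then obtain z where z: "z \<in> affine_chart L (fst q)" "restrict_pair (fst q, z) = q"
    "equivclp (glue L \<Sigma>) (\<sigma>, x) (fst q, z)" by blast
  from step.hyps(2) show ?case
  proof
    assume "glue L\<^sub>1 \<Sigma> q r"
    then obtain \<tau> \<rho> y1 where *: "\<tau> \<in> \<Sigma>" "\<rho> \<in> \<Sigma>" "y1 \<in> affine_chart L\<^sub>1 \<tau>" "\<tau> face_of \<rho>"
        "q = (\<tau>, y1)" "r = (\<rho>, restrict y1 (cone_monoid L\<^sub>1 \<rho>))"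
      unfolding glue_def by blast
    let ?w = "restrict z (cone_monoid L \<rho>)"
    have zL: "z \<in> affine_chart L \<tau>" using z(1) *(5) by simp
    have w: "?w \<in> affine_chart L \<rho>" by (rule restrict_affine_chart[OF zL face_of_imp_subset[OF *(4)]])
    have "glue L \<Sigma> (\<tau>, z) (\<rho>, ?w)" unfolding glue_def using * zL by blast
    then have g: "equivclp (glue L \<Sigma>) (\<sigma>, x) (\<rho>, ?w)"
      using z(3) *(5) by (metis equivclp_into_equivclp fst_conv)
    have "restrict ?w (cone_monoid L\<^sub>1 \<rho>) = restrict y1 (cone_monoid L\<^sub>1 \<rho>)"
    proof -
      have "y1 = restrict z (cone_monoid L\<^sub>1 \<tau>)" using z(2) *(5) by (simp add: restrict_pair_def)
      moreover have "cone_monoid L \<rho> \<inter> cone_monoid L\<^sub>1 \<rho> = cone_monoid L\<^sub>1 \<tau> \<inter> cone_monoid L\<^sub>1 \<rho>"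
        using cone_monoid_subset[of \<rho>] cone_monoid_antimono[OF face_of_imp_subset[OF *(4)], of L\<^sub>1] by blast
      ultimately show ?thesis by simp
    qed
    then have r: "restrict_pair (\<rho>, ?w) = r" by (simp only: restrict_pair_def *(6) fst_conv snd_conv)
    have "fst r = \<rho>" by (simp add: *(6))
    then show ?thesis using r g w by (metis (no_types, lifting))
  next
    assume "glue L\<^sub>1 \<Sigma> r q"
    then obtain \<tau> \<rho> y1 where *: "\<tau> \<in> \<Sigma>" "\<rho> \<in> \<Sigma>" "y1 \<in> affine_chart L\<^sub>1 \<tau>" "\<tau> face_of \<rho>"
        "r = (\<tau>, y1)" "q = (\<rho>, restrict y1 (cone_monoid L\<^sub>1 \<rho>))"
      unfolding glue_def by blast
    have zL: "z \<in> affine_chart L \<rho>" using z(1) *(6) by simp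
    have zy: "restrict z (cone_monoid L\<^sub>1 \<rho>) = restrict y1 (cone_monoid L\<^sub>1 \<rho>)"
      using z(2) *(6) by (simp add: restrict_pair_def)
    obtain y where y: "y \<in> affine_chart L \<tau>" "restrict y (cone_monoid L \<rho>) = z"
        "restrict y (cone_monoid L\<^sub>1 \<tau>) = y1"
      using extend_to_face_chart[OF *(1,2,4) zL *(3) zy] by blast
    have "glue L \<Sigma> (\<tau>, y) (\<rho>, z)" unfolding glue_def using * y by blast
    then have "equivclp (glue L \<Sigma>) (\<sigma>, x) (\<tau>, y)"
      using z(3) *(6) by (metis equivclp_into_equivclp fst_conv)
    then show ?thesis using y *(5) by (intro bexI[of _ y]) (simp_all add: restrict_pair_def)
  qed
qed

text \<open>
  The quotient map, as a map on gluing classes.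
\<close>

definition descend_point :: "'a toric_point \<Rightarrow> 'a toric_point" where
  "descend_point C = {q. \<exists>p\<in>C. equivclp (glue L\<^sub>1 \<Sigma>) (restrict_pair p) q}"

lemma descend_point_chart_map:
  "descend_point (chart_map L \<Sigma> \<sigma> x) = chart_map L\<^sub>1 \<Sigma> \<sigma> (restrict x (cone_monoid L\<^sub>1 \<sigma>))"
proof -
  have e: "(\<sigma>, restrict x (cone_monoid L\<^sub>1 \<sigma>)) = restrict_pair (\<sigma>, x)" by (simp add: restrict_pair_def)
  show ?thesis
    unfolding descend_point_def chart_map_def e
  proof (intro subset_antisym subsetI)
    fix q assume "q \<in> {q. \<exists>p\<in>{p. equivclp (glue L \<Sigma>) (\<sigma>, x) p}. equivclp (glue L\<^sub>1 \<Sigma>) (restrict_pair p) q}"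
    then obtain p where "equivclp (glue L \<Sigma>) (\<sigma>, x) p" "equivclp (glue L\<^sub>1 \<Sigma>) (restrict_pair p) q"
      by blast
    then show "q \<in> {q. equivclp (glue L\<^sub>1 \<Sigma>) (restrict_pair (\<sigma>, x)) q}"
      using equivclp_trans[OF equivclp_glue_restrict] by blast
  next
    fix q assume "q \<in> {q. equivclp (glue L\<^sub>1 \<Sigma>) (restrict_pair (\<sigma>, x)) q}"
    moreover have "equivclp (glue L \<Sigma>) (\<sigma>, x) (\<sigma>, x)" by simp
    ultimately show "q \<in> {q. \<exists>p\<in>{p. equivclp (glue L \<Sigma>) (\<sigma>, x) p}. equivclp (glue L\<^sub>1 \<Sigma>) (restrict_pair p) q}"
      by blast
  qed
qed

lemma descend_point_image: "descend_point ` toric_points L \<Sigma> = toric_points L\<^sub>1 \<Sigma>"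
proof (intro subset_antisym subsetI)
  fix q assume "q \<in> toric_points L\<^sub>1 \<Sigma>"
  then obtain \<sigma> y where y: "\<sigma> \<in> \<Sigma>" "y \<in> affine_chart L\<^sub>1 \<sigma>" "q = chart_map L\<^sub>1 \<Sigma> \<sigma> y"
    by (auto simp: toric_points_def)
  obtain x where "x \<in> affine_chart L \<sigma>" "restrict x (cone_monoid L\<^sub>1 \<sigma>) = y"
    using extend_chart_point[OF y(2)] by blast
  with y show "q \<in> descend_point ` toric_points L \<Sigma>"
    by (auto simp: toric_points_def descend_point_chart_map intro!: image_eqI[of _ _ "chart_map L \<Sigma> \<sigma> x"])
next
  fix q assume "q \<in> descend_point ` toric_points L \<Sigma>"
  then obtain \<sigma> x where "\<sigma> \<in> \<Sigma>" "x \<in> affine_chart L \<sigma>"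
      "q = chart_map L\<^sub>1 \<Sigma> \<sigma> (restrict x (cone_monoid L\<^sub>1 \<sigma>))"
    by (auto simp: toric_points_def descend_point_chart_map)
  then show "q \<in> toric_points L\<^sub>1 \<Sigma>" using restrict_chart unfolding toric_points_def by blast
qed

lemma descend_point_torus_act:
  assumes "p \<in> toric_points L \<Sigma>" "n \<in> L\<^sub>1"
  shows "descend_point (torus_act L n p) = descend_point p"
  using assms(1) torus_act_chart_map[OF _ zero_mem]
  by (auto simp: toric_points_def descend_point_chart_map restrict_translate[OF assms(2)])

text \<open>
  Lifting the chain of gluings reduces the claim to two points of one chart with the same restriction.
\<close>

lemma descend_point_fibre:
  assumes "p \<in> toric_points L \<Sigma>" "p' \<in> toric_points L \<Sigma>" "descend_point p = descend_point p'"
  obtains n where "n \<in> L\<^sub>1" "p' = torus_act L n p"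
proof -
  obtain \<sigma> x where x: "x \<in> affine_chart L \<sigma>" "p = chart_map L \<Sigma> \<sigma> x"
    using assms(1) by (auto simp: toric_points_def)
  obtain \<sigma>' x' where x': "x' \<in> affine_chart L \<sigma>'" "p' = chart_map L \<Sigma> \<sigma>' x'"
    using assms(2) by (auto simp: toric_points_def)
  have "equivclp (glue L\<^sub>1 \<Sigma>) (restrict_pair (\<sigma>, x)) (restrict_pair (\<sigma>', x'))"
    using assms(3) by (simp add: x x' descend_point_chart_map chart_map_eq_iff restrict_pair_def)
  then obtain z where z: "z \<in> affine_chart L \<sigma>'"
      "restrict_pair (\<sigma>', z) = restrict_pair (\<sigma>', x')" "equivclp (glue L \<Sigma>) (\<sigma>, x) (\<sigma>', z)"
    using equivclp_glue_lift[OF _ x(1)] by (force simp: restrict_pair_def)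
  obtain n where n: "n \<in> L\<^sub>1" "x' = translate L \<sigma>' n z"
    using chart_fibre_is_orbit[OF z(1) x'(1)] z(2) by (auto simp: restrict_pair_def)
  have "p' = torus_act L n p"
    using z(3) by (simp add: x x' n(2) torus_act_chart_map[OF z(1) zero_mem] flip: chart_map_eq_iff)
  with n(1) show thesis by (rule that)
qed

lemma orbit_eq_iff:
  assumes p: "p \<in> toric_points L \<Sigma>" and p': "p' \<in> toric_points L \<Sigma>"
  shows "orbit_of (torus_act L ` L\<^sub>1) p = orbit_of (torus_act L ` L\<^sub>1) p' \<longleftrightarrow> descend_point p = descend_point p'"
proof -
  have orbit: "orbit_of (torus_act L ` L\<^sub>1) q = (\<lambda>n. torus_act L n q) ` L\<^sub>1" for q
    by (auto simp: orbit_of_def)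
  show ?thesis
    unfolding orbit
  proof
    assume eq: "(\<lambda>n. torus_act L n p) ` L\<^sub>1 = (\<lambda>n. torus_act L n p') ` L\<^sub>1"
    have "torus_act L 0 p = p"
      using p chart_act_trivial[OF zero_mem]
      by (auto simp: toric_points_def torus_act_chart_map[OF _ zero_mem])
    then have "p \<in> (\<lambda>n. torus_act L n p) ` L\<^sub>1" using L1_closed(1) by (simp add: rev_image_eqI)
    then obtain n where "n \<in> L\<^sub>1" "p = torus_act L n p'" unfolding eq by auto
    then show "descend_point p = descend_point p'" using descend_point_torus_act[OF p'] by simp
  next
    assume "descend_point p = descend_point p'"
    then obtain n where n: "n \<in> L\<^sub>1" "p' = torus_act L n p" using descend_point_fibre[OF p p'] by blast
    have "torus_act L k p' = torus_act L (k + n) p" "torus_act L k p = torus_act L (k - n) p'" for k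
      by (simp_all add: n(2) torus_act_add)
    then show "(\<lambda>n. torus_act L n p) ` L\<^sub>1 = (\<lambda>n. torus_act L n p') ` L\<^sub>1"
      using L1_closed(2,3)[OF _ n(1)] by blast
  qed
qed

lemma chart_preimage_descend:
  assumes "\<sigma> \<in> \<Sigma>"
  shows "chart_preimage L \<Sigma> \<sigma> {p \<in> toric_points L \<Sigma>. descend_point p \<in> V} =
    {x \<in> affine_chart L \<sigma>. restrict x (cone_monoid L\<^sub>1 \<sigma>) \<in> chart_preimage L\<^sub>1 \<Sigma> \<sigma> V}"
  using assms restrict_chart by (auto simp: chart_preimage_def toric_points_def descend_point_chart_map)

lemma openin_descend_iff:
  assumes "V \<subseteq> toric_points L\<^sub>1 \<Sigma>"
  shows "openin (zariski (toric_variety L \<Sigma>)) {p \<in> toric_points L \<Sigma>. descend_point p \<in> V} \<longleftrightarrow>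
    openin (zariski (toric_variety L\<^sub>1 \<Sigma>)) V"
proof -
  have "chart_preimage L\<^sub>1 \<Sigma> \<sigma> V \<subseteq> affine_chart L\<^sub>1 \<sigma>" for \<sigma> by (auto simp: chart_preimage_def)
  then show ?thesis
    using assms by (auto simp: openin_toric_variety chart_preimage_descend openin_chart_restrict_iff)
qed

text \<open>
  For the descent of a regular function, let it be \<open>a / b\<close> near \<open>x\<close>, on a set containing the nonvanishing
  locus of \<open>s\<close>. Then \<open>f (s b) = s a\<close> holds on the whole chart, in particular on all orbits, since both
  sides vanish with \<open>s\<close>. This is what makes \<open>invariant_relation_descends\<close> applicable, although \<open>b\<close> may
  vanish elsewhere on the orbit of \<open>x\<close>.
\<close>

lemma regular_descend_iff:
  assumes V: "openin (zariski (toric_variety L\<^sub>1 \<Sigma>)) V"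
    and h: "\<And>p. p \<in> toric_points L \<Sigma> \<Longrightarrow> h p = f (descend_point p)"
  shows "f \<in> regular (toric_variety L\<^sub>1 \<Sigma>) V \<longleftrightarrow>
    h \<in> regular (toric_variety L \<Sigma>) {p \<in> toric_points L \<Sigma>. descend_point p \<in> V}"
proof -
  let ?r = "\<lambda>\<sigma> x. restrict x (cone_monoid L\<^sub>1 \<sigma>)"
  let ?U = "{p \<in> toric_points L \<Sigma>. descend_point p \<in> V}"
  have hf: "h (chart_map L \<Sigma> \<sigma> x) = f (chart_map L\<^sub>1 \<Sigma> \<sigma> (?r \<sigma> x))"
    if "\<sigma> \<in> \<Sigma>" "x \<in> affine_chart L \<sigma>" for \<sigma> x
    using h[of "chart_map L \<Sigma> \<sigma> x"] that by (auto simp: descend_point_chart_map toric_points_def)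
  have sub1: "chart_preimage L\<^sub>1 \<Sigma> \<sigma> V \<subseteq> affine_chart L\<^sub>1 \<sigma>" for \<sigma> by (auto simp: chart_preimage_def)
  show ?thesis
  proof
    assume f: "f \<in> regular (toric_variety L\<^sub>1 \<Sigma>) V"
    show "h \<in> regular (toric_variety L \<Sigma>) ?U"
      unfolding mem_regular_toric_variety
    proof (intro ballI)
      fix \<sigma> x assume \<sigma>: "\<sigma> \<in> \<Sigma>" and "x \<in> chart_preimage L \<Sigma> \<sigma> ?U"
      then have x: "x \<in> affine_chart L \<sigma>" "?r \<sigma> x \<in> chart_preimage L\<^sub>1 \<Sigma> \<sigma> V"
        by (auto simp: chart_preimage_descend)
      then obtain W a b where W: "openin (chart_topology L\<^sub>1 \<sigma>) W" "?r \<sigma> x \<in> W"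
          "W \<subseteq> chart_preimage L\<^sub>1 \<Sigma> \<sigma> V"
        and ab: "a \<in> coordinate_ring L\<^sub>1 \<sigma>" "b \<in> coordinate_ring L\<^sub>1 \<sigma>"
          "\<forall>z\<in>W. b z \<noteq> 0 \<and> f (chart_map L\<^sub>1 \<Sigma> \<sigma> z) = a z / b z"
        using bspec[OF bspec[OF iffD1[OF mem_regular_toric_variety f] \<sigma>] x(2)] by blast
      let ?W = "{x \<in> affine_chart L \<sigma>. ?r \<sigma> x \<in> W}"
      have "openin (chart_topology L \<sigma>) ?W"
        using openin_chart_restrict_iff[of W \<sigma>] W(1,3) sub1[of \<sigma>] by blast
      moreover have "?W \<subseteq> chart_preimage L \<Sigma> \<sigma> ?U" using W(3) by (auto simp: chart_preimage_descend[OF \<sigma>])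
      moreover have "\<forall>z\<in>?W. b z \<noteq> 0 \<and> h (chart_map L \<Sigma> \<sigma> z) = a z / b z"
      proof
        fix z assume "z \<in> ?W"
        then show "b z \<noteq> 0 \<and> h (chart_map L \<Sigma> \<sigma> z) = a z / b z"
          using bspec[OF ab(3), of "?r \<sigma> z"] hf[OF \<sigma>, of z]
          by (simp add: coordinate_ring_restrict(2)[OF ab(1)] coordinate_ring_restrict(2)[OF ab(2)])
      qed
      ultimately show "\<exists>W. openin (chart_topology L \<sigma>) W \<and> x \<in> W \<and> W \<subseteq> chart_preimage L \<Sigma> \<sigma> ?U \<and>
          (\<exists>a\<in>coordinate_ring L \<sigma>. \<exists>b\<in>coordinate_ring L \<sigma>.
             \<forall>z\<in>W. b z \<noteq> 0 \<and> h (chart_map L \<Sigma> \<sigma> z) = a z / b z)"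
        using x(1) W(2) coordinate_ring_restrict(1)[OF ab(1)] coordinate_ring_restrict(1)[OF ab(2)]
        by (intro exI[of _ ?W] conjI bexI[of _ a] bexI[of _ b]) auto
    qed
  next
    assume hreg: "h \<in> regular (toric_variety L \<Sigma>) ?U"
    show "f \<in> regular (toric_variety L\<^sub>1 \<Sigma>) V"
      unfolding mem_regular_toric_variety
    proof (intro ballI)
      fix \<sigma> y assume \<sigma>: "\<sigma> \<in> \<Sigma>" and y: "y \<in> chart_preimage L\<^sub>1 \<Sigma> \<sigma> V"
      obtain x where x: "x \<in> affine_chart L \<sigma>" "?r \<sigma> x = y"
        using extend_chart_point y sub1 by blast
      then have x_pre: "x \<in> chart_preimage L \<Sigma> \<sigma> ?U" using y by (simp add: chart_preimage_descend[OF \<sigma>])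
      obtain W a b where W: "openin (chart_topology L \<sigma>) W" "x \<in> W"
        and ab: "a \<in> coordinate_ring L \<sigma>" "b \<in> coordinate_ring L \<sigma>"
          "\<forall>z\<in>W. b z \<noteq> 0 \<and> h (chart_map L \<Sigma> \<sigma> z) = a z / b z"
        using bspec[OF bspec[OF iffD1[OF mem_regular_toric_variety hreg] \<sigma>] x_pre] by blast
      obtain s where s: "s \<in> coordinate_ring L \<sigma>" "s x \<noteq> 0" "\<forall>z\<in>affine_chart L \<sigma>. s z \<noteq> 0 \<longrightarrow> z \<in> W"
        using bspec[OF conjunct2[OF iffD1[OF openin_chart_topology W(1)]] W(2)] by blast
      obtain sa where sa: "sa \<in> coordinate_ring L \<sigma>" "\<And>z. z \<in> affine_chart L \<sigma> \<Longrightarrow> sa z = s z * a z"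
        using coordinate_ring_mult[OF s(1) ab(1)] by blast
      obtain sb where sb: "sb \<in> coordinate_ring L \<sigma>" "\<And>z. z \<in> affine_chart L \<sigma> \<Longrightarrow> sb z = s z * b z"
        using coordinate_ring_mult[OF s(1) ab(2)] by blast
      have global: "f (chart_map L\<^sub>1 \<Sigma> \<sigma> (?r \<sigma> z)) * sb z = sa z" if z: "z \<in> affine_chart L \<sigma>" for z
      proof (cases "s z = 0")
        case True
        then show ?thesis by (simp add: sa(2)[OF z] sb(2)[OF z])
      next
        case False
        then have "z \<in> W" using s(3) z by blast
        then have "b z \<noteq> 0 \<and> f (chart_map L\<^sub>1 \<Sigma> \<sigma> (?r \<sigma> z)) = a z / b z"
          using ab(3) hf[OF \<sigma> z] by auto
        then show ?thesis by (simp add: sa(2)[OF z] sb(2)[OF z])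
      qed
      have sb_nz: "sb x \<noteq> 0" using s(2) ab(3) W(2) by (simp add: sb(2)[OF x(1)])
      obtain a1 b1 where a1: "a1 \<in> coordinate_ring L\<^sub>1 \<sigma>" and b1: "b1 \<in> coordinate_ring L\<^sub>1 \<sigma>" "b1 x \<noteq> 0"
        and rel: "\<forall>z\<in>affine_chart L \<sigma>. \<forall>\<alpha> \<beta>.
         (\<forall>n\<in>L\<^sub>1. \<alpha> * sb (translate L \<sigma> n z) = \<beta> * sa (translate L \<sigma> n z)) \<longrightarrow>
         \<alpha> * b1 z = \<beta> * a1 z"
        using invariant_relation_descends[OF sa(1) sb(1) x(1) sb_nz] by (elim bexE conjE)
      let ?W1 = "{w \<in> chart_preimage L\<^sub>1 \<Sigma> \<sigma> V. b1 w \<noteq> 0}"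
      have f_eq: "f (chart_map L\<^sub>1 \<Sigma> \<sigma> w) * b1 w = a1 w" if w: "w \<in> affine_chart L\<^sub>1 \<sigma>" for w
      proof -
        obtain z where z: "z \<in> affine_chart L \<sigma>" "?r \<sigma> z = w" using extend_chart_point[OF w] by blast
        have "f (chart_map L\<^sub>1 \<Sigma> \<sigma> w) * sb (translate L \<sigma> n z) = 1 * sa (translate L \<sigma> n z)"
          if "n \<in> L\<^sub>1" for n
          using global[OF chart_act_affine_chart[OF z(1)], of n] restrict_translate[OF that, of \<sigma> z] z(2) by simp
        then have "f (chart_map L\<^sub>1 \<Sigma> \<sigma> w) * b1 z = 1 * a1 z"
          using spec[OF spec[OF bspec[OF rel z(1)], of "f (chart_map L\<^sub>1 \<Sigma> \<sigma> w)"], of 1] by blast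
        then show ?thesis
          using coordinate_ring_restrict(2)[OF a1, of z] coordinate_ring_restrict(2)[OF b1(1), of z] z(2) by simp
      qed
      have "openin (chart_topology L\<^sub>1 \<sigma>) {w \<in> affine_chart L\<^sub>1 \<sigma>. b1 w \<noteq> 0}"
        unfolding chart_topology_def using b1(1) by (intro topology_generated_by_Basis) blast
      moreover have "openin (chart_topology L\<^sub>1 \<sigma>) (chart_preimage L\<^sub>1 \<Sigma> \<sigma> V)"
        using V \<sigma> by (simp add: openin_toric_variety)
      moreover have "?W1 = {w \<in> affine_chart L\<^sub>1 \<sigma>. b1 w \<noteq> 0} \<inter> chart_preimage L\<^sub>1 \<Sigma> \<sigma> V"
        using sub1[of \<sigma>] by blast
      ultimately have W1: "openin (chart_topology L\<^sub>1 \<sigma>) ?W1" by (simp add: openin_Int)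
      have y_in: "y \<in> ?W1" using y b1(2) coordinate_ring_restrict(2)[OF b1(1), of x] x(2) by simp
      have quot: "\<forall>w\<in>?W1. b1 w \<noteq> 0 \<and> f (chart_map L\<^sub>1 \<Sigma> \<sigma> w) = a1 w / b1 w"
        using f_eq sub1[of \<sigma>] by (auto simp: field_simps)
      show "\<exists>W. openin (chart_topology L\<^sub>1 \<sigma>) W \<and> y \<in> W \<and> W \<subseteq> chart_preimage L\<^sub>1 \<Sigma> \<sigma> V \<and>
          (\<exists>a\<in>coordinate_ring L\<^sub>1 \<sigma>. \<exists>b\<in>coordinate_ring L\<^sub>1 \<sigma>.
             \<forall>z\<in>W. b z \<noteq> 0 \<and> f (chart_map L\<^sub>1 \<Sigma> \<sigma> z) = a z / b z)"
        by (intro exI[of _ ?W1] conjI bexI[OF _ a1] bexI[OF _ b1(1)] W1 y_in quot) blast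
    qed
  qed
qed

lemma quotient_iso_toric_variety:
  "fun_space_iso (quotient_space (toric_variety L \<Sigma>) (torus_act L ` L\<^sub>1)) (toric_variety L\<^sub>1 \<Sigma>)"
proof (rule fun_space_iso_quotient[where \<Psi> = descend_point], unfold points_toric_variety)
  show "f \<in> fun_space.regular (toric_variety L\<^sub>1 \<Sigma>) V \<longleftrightarrow>
      h \<in> fun_space.regular (toric_variety L \<Sigma>) {p \<in> toric_points L \<Sigma>. descend_point p \<in> V}"
    if "openin (zariski (toric_variety L\<^sub>1 \<Sigma>)) V"
      "\<And>p. p \<in> toric_points L \<Sigma> \<Longrightarrow> h p = f (descend_point p)" for V f h
    using that by (rule regular_descend_iff)
qed (simp_all add: descend_point_image orbit_eq_iff openin_descend_iff)

end

section \<open>Polar duality and the spanning fan\<close>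
lemma polytope_hull_vertices:
  assumes "polytope R"
  shows "R = convex hull (vertices R)"
  unfolding vertices_def
  by (rule Krein_Milman_Minkowski) (use assms in \<open>auto simp: polytope_imp_compact polytope_imp_convex\<close>)

lemma finite_vertices: "polytope R \<Longrightarrow> finite (vertices R)"
  unfolding vertices_def by (intro finite_polyhedron_extreme_points polytope_imp_polyhedron)

lemma polar_dual_polar_dual:
  assumes "convex R" "closed R" "0 \<in> R"
  shows "polar_dual (polar_dual R) = R"
proof (intro subset_antisym subsetI)
  fix v assume v: "v \<in> polar_dual (polar_dual R)"
  show "v \<in> R"
  proof (rule ccontr)
    assume "v \<notin> R"
    then obtain a b where "a \<bullet> v < b" "\<forall>x\<in>R. b < a \<bullet> x"
      using separating_hyperplane_closed_point[OF assms(1,2)] by blast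
    then obtain c where ab: "a \<bullet> v < - c" "\<forall>x\<in>R. - c < a \<bullet> x" by (metis minus_minus)
    then have "0 < c" using assms(3) by force
    have "- 1 \<le> ((1 / c) *\<^sub>R a) \<bullet> x" if "x \<in> R" for x
      using bspec[OF ab(2) that] \<open>0 < c\<close> by (simp add: field_simps)
    then have mem: "(1 / c) *\<^sub>R a \<in> polar_dual R" unfolding polar_dual_def by blast
    have "- 1 \<le> v \<bullet> ((1 / c) *\<^sub>R a)"
      using v mem unfolding polar_dual_def[of "polar_dual R"] by blast
    then show False using ab(1) \<open>0 < c\<close> by (simp add: field_simps inner_commute)
  qed
qed (auto simp: polar_dual_def inner_commute)

lemma zero_in_interior_polar_dual:
  assumes "bounded R"
  shows "0 \<in> interior (polar_dual R)"
proof -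
  obtain r where r: "r > 0" "\<And>w. w \<in> R \<Longrightarrow> norm w \<le> r" using assms bounded_pos by blast
  have "ball 0 (1 / r) \<subseteq> polar_dual R"
  proof
    fix v :: 'a assume "v \<in> ball 0 (1 / r)"
    then have v: "norm v \<le> 1 / r" by simp
    show "v \<in> polar_dual R"
      unfolding polar_dual_def
    proof (intro CollectI ballI)
      fix w assume w: "w \<in> R"
      have "\<bar>v \<bullet> w\<bar> \<le> norm v * norm w" by (rule Cauchy_Schwarz_ineq2)
      also have "\<dots> \<le> 1 / r * r" using v r(2)[OF w] r(1) by (intro mult_mono) auto
      finally show "- 1 \<le> v \<bullet> w" using r(1) by simp
    qed
  qed
  then show ?thesis using r(1) by (auto simp: mem_interior intro!: exI[of _ "1 / r"])
qed

lemma proper_face_exposed_by_polar_dual: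
  assumes R: "polytope R" "0 \<in> interior R" and F: "F face_of R" "F \<noteq> R"
  obtains w where "w \<in> polar_dual R" "F = {x \<in> R. w \<bullet> x = -1}"
proof (cases "F = {}")
  case True
  \<comment> \<open>The functional 0 never takes the value \<open>-1\<close>.\<close>
  then show thesis by (intro that[of 0]) (auto simp: polar_dual_def)
next
  case False
  have "F exposed_face_of R"
    using F(1) exposed_face_of_polyhedron[OF polytope_imp_polyhedron[OF R(1)]] by blast
  then obtain a b where ab: "R \<subseteq> {x. a \<bullet> x \<le> b}" "F = R \<inter> {x. a \<bullet> x = b}"
    unfolding exposed_face_of_def by blast
  have "0 \<in> R" using R(2) interior_subset by blast
  moreover have "0 \<notin> F" using face_of_disjoint_interior[OF F] R(2) by blast
  ultimately have b: "b > 0" using ab by force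
  show thesis
    by (rule that[of "(- 1 / b) *\<^sub>R a"]) (use ab b in \<open>auto simp: polar_dual_def field_simps\<close>)
qed

text \<open>
  A face is cut out by a point \<open>w\<close> of the polar dual, which is a convex combination of vertices \<open>u\<close>. The
  functions \<open>u + 1\<close> are nonnegative on \<open>R\<close>, so those with positive weight vanish on the face, and one
  of them does not vanish at \<open>v\<close>. For the empty face, this yields a vertex with value above \<open>-1\<close> at \<open>v\<close>.
\<close>

lemma facet_normal_separating_point:
  assumes R: "polytope R" "0 \<in> interior R" "polytope (polar_dual R)"
    and G: "G face_of R" and v: "v \<in> R" "v \<notin> G"
  obtains u where "u \<in> vertices (polar_dual R)" "\<And>x. x \<in> G \<Longrightarrow> u \<bullet> x = -1" "u \<bullet> v > -1"
proof -
  have "G \<noteq> R" using v by blast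
  then obtain w where w: "w \<in> polar_dual R" "G = {x \<in> R. w \<bullet> x = -1}"
    using proper_face_exposed_by_polar_dual[OF R(1,2) G] by blast
  let ?V = "vertices (polar_dual R)"
  have fin: "finite ?V" by (rule finite_vertices[OF R(3)])
  have "w \<in> convex hull ?V" using w(1) polytope_hull_vertices[OF R(3)] by simp
  then obtain c where c: "\<And>u. u \<in> ?V \<Longrightarrow> 0 \<le> c u" "sum c ?V = 1" "(\<Sum>u\<in>?V. c u *\<^sub>R u) = w"
    unfolding convex_hull_finite[OF fin] by blast
  have sum: "(\<Sum>u\<in>?V. c u * (u \<bullet> x + 1)) = w \<bullet> x + 1" for x
    by (simp add: distrib_left sum.distrib c(2) inner_sum_left flip: c(3))
  have nonneg: "0 \<le> c u * (u \<bullet> x + 1)" if "u \<in> ?V" "x \<in> R" for u x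
  proof -
    have "u \<in> polar_dual R" using that(1) by (simp add: vertices_def extreme_point_of_def)
    then have "- 1 \<le> u \<bullet> x" using that(2) by (simp add: polar_dual_def)
    then show ?thesis using c(1)[OF that(1)] by simp
  qed
  have "w \<bullet> v \<ge> -1" using w(1) v(1) by (simp add: polar_dual_def)
  then have "w \<bullet> v + 1 \<noteq> 0" using w(2) v by auto
  then obtain u where u: "u \<in> ?V" "c u * (u \<bullet> v + 1) \<noteq> 0"
    using sum.neutral[of ?V "\<lambda>u. c u * (u \<bullet> v + 1)"] sum[of v] by auto
  have "c u > 0" using u c(1)[OF u(1)] by (auto simp: less_le)
  moreover have "c u * (u \<bullet> v + 1) > 0" by (rule le_neq_trans[OF nonneg[OF u(1) v(1)] u(2)[symmetric]])
  ultimately have "u \<bullet> v > -1" by (simp add: zero_less_mult_iff)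
  moreover have "u \<bullet> x = -1" if "x \<in> G" for x
  proof -
    have "x \<in> R" "(\<Sum>u\<in>?V. c u * (u \<bullet> x + 1)) = 0" using that w(2) by (auto simp: sum)
    then have "c u * (u \<bullet> x + 1) = 0"
      using sum_nonneg_eq_0_iff[OF fin, of "\<lambda>u. c u * (u \<bullet> x + 1)"] nonneg u(1) by blast
    with \<open>c u > 0\<close> show ?thesis by simp
  qed
  ultimately show thesis using that u(1) by blast
qed

lemma dual_cone_hull: "dual_cone (convex_cone hull F) = {m. \<forall>v\<in>F. 0 \<le> m \<bullet> v}"
proof (intro subset_antisym subsetI CollectI)
  fix m assume "m \<in> {m. \<forall>v\<in>F. 0 \<le> m \<bullet> v}"
  then have "convex_cone hull F \<subseteq> {x. m \<bullet> x \<ge> 0}"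
    by (intro hull_minimal convex_cone_halfspace_ge) auto
  then show "m \<in> dual_cone (convex_cone hull F)" by (auto simp: dual_cone_def)
qed (auto simp: dual_cone_def intro: hull_inc)

lemma dual_cone_hull_polytope:
  assumes "polytope F"
  shows "dual_cone (convex_cone hull F) = {m. \<forall>v\<in>vertices F. 0 \<le> m \<bullet> v}"
proof -
  have "F \<subseteq> {x. m \<bullet> x \<ge> 0}" if "\<forall>v\<in>vertices F. 0 \<le> m \<bullet> v" for m
    by (subst polytope_hull_vertices[OF assms], rule hull_minimal)
       (use that convex_halfspace_ge[of 0 m] in auto)
  moreover have "vertices F \<subseteq> F" by (auto simp: vertices_def extreme_point_of_def)
  ultimately show ?thesis unfolding dual_cone_hull by blast
qed

text \<open>
  Let \<open>\<sigma>\<close> and \<open>\<tau>\<close> be the cones over the faces \<open>F\<close> and \<open>G\<close>, and \<open>u0\<close> a vertex of the polar dual that is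
  \<open>-1\<close> on \<open>F\<close>. For each vertex \<open>u\<close> that is \<open>-1\<close> on \<open>G\<close>, the difference \<open>u - u0\<close> is nonnegative on \<open>F\<close>
  and vanishes on \<open>G\<close>. The sum \<open>m0\<close> of these differences is positive on the rest of \<open>F\<close>, because \<open>G\<close> is
  the intersection of the facets containing it, and it lies in the dual lattice together with the
  vertices \<open>u\<close>.
\<close>

lemma face_cone_separation:
  assumes R: "polytope R" "0 \<in> interior R" "polytope (polar_dual R)"
    and normals: "vertices (polar_dual R) \<subseteq> dual_lattice K"
    and \<tau>: "\<tau> \<in> spanning_fan R" and \<sigma>: "\<sigma> \<in> spanning_fan R" and sub: "\<tau> \<subseteq> \<sigma>"
  shows "\<exists>m0\<in>cone_monoid K \<sigma>. - m0 \<in> cone_monoid K \<tau> \<and>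
      (\<forall>m\<in>dual_cone \<tau>. \<exists>k::nat. m + of_nat k *\<^sub>R m0 \<in> dual_cone \<sigma>)"
proof -
  let ?V = "vertices (polar_dual R)"
  obtain F where F: "F face_of R" "F \<noteq> R" "\<sigma> = convex_cone hull F"
    using \<sigma> by (auto simp: spanning_fan_def)
  obtain G where G: "G face_of R" "G \<noteq> R" "\<tau> = convex_cone hull G"
    using \<tau> by (auto simp: spanning_fan_def)
  have FR: "F \<subseteq> R" and GR: "G \<subseteq> R" using F(1) G(1) face_of_imp_subset by blast+
  have ge: "- 1 \<le> u \<bullet> x" if "u \<in> ?V" "x \<in> R" for u x
    using that by (auto simp: vertices_def extreme_point_of_def polar_dual_def)
  obtain v0 where "v0 \<in> R" "v0 \<notin> F" using FR F(2) by blast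
  then obtain u0 where u0: "u0 \<in> ?V" "\<And>x. x \<in> F \<Longrightarrow> u0 \<bullet> x = -1"
    using facet_normal_separating_point[OF R F(1)] by metis
  \<comment> \<open>The points of \<open>G\<close> lie in the cone over \<open>F\<close>, where no point of the polar dual is below \<open>u0\<close>.\<close>
  have u0G: "u0 \<bullet> x = -1" if x: "x \<in> G" for x
  proof -
    obtain v1 where "v1 \<in> R" "v1 \<notin> G" using GR G(2) by blast
    then obtain u1 where u1: "u1 \<in> ?V" "\<And>x. x \<in> G \<Longrightarrow> u1 \<bullet> x = -1"
      using facet_normal_separating_point[OF R G(1)] by metis
    have "u1 - u0 \<in> dual_cone \<sigma>"
      unfolding F(3) dual_cone_hull using ge[OF u1(1)] FR u0(2) by (force simp: inner_diff_left)
    moreover have "x \<in> \<sigma>" using x sub unfolding G(3) by (auto intro: hull_inc)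
    ultimately have "u0 \<bullet> x \<le> u1 \<bullet> x" by (auto simp: dual_cone_def inner_diff_left)
    then show ?thesis using u1(2)[OF x] ge[OF u0(1), of x] x GR by auto
  qed
  define U where "U = {u \<in> ?V. \<forall>x\<in>G. u \<bullet> x = -1}"
  have fin: "finite U" using finite_vertices[OF R(3)] by (simp add: U_def)
  define m0 where "m0 = (\<Sum>u\<in>U. u - u0)"
  have m0: "m0 \<bullet> x = (\<Sum>u\<in>U. u \<bullet> x - u0 \<bullet> x)" for x
    by (simp add: m0_def inner_sum_left inner_diff_left)
  have m0_dual: "m0 \<in> dual_lattice K"
    unfolding m0_def using normals u0(1) by (intro dual_lattice_sum dual_lattice_diff) (auto simp: U_def)
  have m0_nonneg: "0 \<le> u \<bullet> x - u0 \<bullet> x" if "x \<in> F" "u \<in> U" for x u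
    using ge[of u x] u0(2)[OF that(1)] that FR by (auto simp: U_def)
  have m0F: "0 \<le> m0 \<bullet> x" if "x \<in> F" for x
    unfolding m0 using m0_nonneg[OF that] by (rule sum_nonneg)
  have m0G: "m0 \<bullet> x = 0" if "x \<in> G" for x
    unfolding m0 using that u0G by (intro sum.neutral) (auto simp: U_def)
  have m0_pos: "0 < m0 \<bullet> x" if x: "x \<in> F" "x \<notin> G" for x
  proof -
    obtain u where u: "u \<in> ?V" "\<And>x. x \<in> G \<Longrightarrow> u \<bullet> x = -1" "u \<bullet> x > -1"
      using facet_normal_separating_point[OF R G(1), of x] x FR by blast
    show ?thesis
      unfolding m0
      by (rule sum_pos2[OF fin, of u]) (use u u0(2) x m0_nonneg in \<open>auto simp: U_def\<close>)
  qed
  have "\<exists>k::nat. m + of_nat k *\<^sub>R m0 \<in> dual_cone \<sigma>" if m: "m \<in> dual_cone \<tau>" for m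
  proof -
    have poly: "polytope F" by (rule face_of_polytope_polytope[OF R(1) F(1)])
    \<comment> \<open>Finitely many vertices have to be made nonnegative; each one is, for all large \<open>k\<close>.\<close>
    have "\<forall>\<^sub>F k::nat in sequentially. 0 \<le> m \<bullet> v + of_nat k * (m0 \<bullet> v)" if "v \<in> vertices F" for v
    proof -
      have vF: "v \<in> F" using that by (simp add: vertices_def extreme_point_of_def)
      show ?thesis
      proof (cases "v \<in> G")
        case True
        then have "0 \<le> m \<bullet> v" using m unfolding G(3) dual_cone_hull by blast
        then show ?thesis using m0G[OF True] by simp
      next
        case False
        then have pos: "0 < m0 \<bullet> v" using m0_pos[OF vF] by blast
        then obtain n :: nat where n: "- (m \<bullet> v) < of_nat n * (m0 \<bullet> v)"
          using ex_less_of_nat_mult by blast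
        have "0 \<le> m \<bullet> v + of_nat k * (m0 \<bullet> v)" if "n \<le> k" for k
        proof -
          have "of_nat n * (m0 \<bullet> v) \<le> of_nat k * (m0 \<bullet> v)"
            using that pos by (intro mult_right_mono) auto
          with n show ?thesis by linarith
        qed
        then show ?thesis by (rule eventually_sequentiallyI)
      qed
    qed
    then have "\<forall>\<^sub>F k::nat in sequentially. \<forall>v\<in>vertices F. 0 \<le> m \<bullet> v + of_nat k * (m0 \<bullet> v)"
      by (intro eventually_ball_finite finite_vertices[OF poly]) blast
    then obtain k :: nat where "\<forall>v\<in>vertices F. 0 \<le> m \<bullet> v + of_nat k * (m0 \<bullet> v)"
      using eventually_happens'[OF sequentially_bot] by blast
    then show ?thesis
      unfolding F(3) dual_cone_hull_polytope[OF poly] by (auto simp: inner_add_left intro!: exI[of _ k])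
  qed
  moreover have "m0 \<in> cone_monoid K \<sigma>"
    using m0_dual m0F unfolding cone_monoid_def F(3) dual_cone_hull by blast
  moreover have "- m0 \<in> cone_monoid K \<tau>"
    using dual_lattice_int_scale[OF m0_dual, of "- 1"] m0G
    unfolding cone_monoid_def G(3) dual_cone_hull by auto
  ultimately show ?thesis by blast
qed

lemma span_vertices:
  assumes "polytope R" "0 \<in> interior R"
  shows "span (vertices R) = UNIV"
proof -
  have "R \<subseteq> span (vertices R)"
    by (subst polytope_hull_vertices[OF assms(1)]) (intro hull_minimal span_superset subspace_imp_convex subspace_span)
  then have "interior R \<subseteq> interior (span (vertices R))" by (rule interior_mono)
  then have "interior (span (vertices R)) \<noteq> {}" using assms(2) by blast
  then show ?thesis
    using empty_interior_lowdim[of "span (vertices R)"] dim_eq_full[of "vertices R"] dim_subset_UNIV[of "vertices R"]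
    by (auto simp: le_less)
qed

lemma toric_quotient_iso:
  assumes R: "polytope R" "0 \<in> interior R" "polytope (polar_dual R)"
    and L1: "full_lattice L\<^sub>1" and L: "0 \<in> L" "vertices R \<subseteq> L" "L \<subseteq> L\<^sub>1"
    and normals: "vertices (polar_dual R) \<subseteq> dual_lattice L\<^sub>1"
  shows "fun_space_iso (toric_quotient L R L\<^sub>1) (polytope_variety L\<^sub>1 R)"
proof -
  interpret fan_in_lattices L L\<^sub>1 "spanning_fan R"
  proof unfold_locales
    show "span L = UNIV" using span_vertices[OF R(1,2)] span_mono[OF L(2)] by blast
    fix \<tau> \<sigma> assume *: "\<tau> \<in> spanning_fan R" "\<sigma> \<in> spanning_fan R" "\<tau> face_of \<sigma>"
    show "\<exists>m0\<in>cone_monoid L\<^sub>1 \<sigma>. - m0 \<in> cone_monoid L\<^sub>1 \<tau> \<and>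
        (\<forall>m\<in>cone_monoid L \<tau>. \<exists>k::nat. m + of_nat k *\<^sub>R m0 \<in> dual_cone \<sigma>)"
      using face_cone_separation[OF R normals *(1,2) face_of_imp_subset[OF *(3)]]
      by (auto simp: cone_monoid_def)
  qed (use L1 L in auto)
  show ?thesis unfolding toric_quotient_def by (rule quotient_iso_toric_variety)
qed

theorem proposition0p4:
  fixes N M Mbar M\<^sub>1 N\<^sub>1 Nbar P Q :: "'a::euclidean_space set"
  assumes "full_lattice N"
    and "fano_polytope N P" and "reflexive_polytope N P"
    and "M = dual_lattice N"
    and "Mbar = int_span (vertices (polar_dual P))"
    and "Q = polar_dual P"
    and "full_lattice M\<^sub>1" and "Mbar \<subseteq> M\<^sub>1" and "M\<^sub>1 \<subseteq> M"
    and "N\<^sub>1 = dual_lattice M\<^sub>1" and "Nbar = dual_lattice Mbar"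
  shows "N \<subseteq> N\<^sub>1 \<and> N\<^sub>1 \<subseteq> Nbar \<and>
    batyrev_borisov_mirror_pair TYPE('a) (toric_quotient N P N\<^sub>1) (toric_quotient Mbar Q M\<^sub>1)"
proof -
  have P: "polytope P" "vertices P \<subseteq> N" "0 \<in> interior P" and Q: "polytope Q"
    using assms(3) by (auto simp: reflexive_polytope_def lattice_polytope_def assms(6))
  have N_N1: "N \<subseteq> N\<^sub>1"
    using subset_dual_dual_lattice[of N] dual_lattice_antimono[OF assms(9)] assms(4,10) by blast
  have N1_Nbar: "N\<^sub>1 \<subseteq> Nbar"
    using dual_lattice_antimono[OF assms(8)] assms(10,11) by simp
  have N1: "full_lattice N\<^sub>1" "dual_lattice N\<^sub>1 = M\<^sub>1"
    using full_lattice_dual[OF assms(7)] dual_dual_lattice[OF assms(7)] assms(10) by simp_all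
  have zero_N: "0 \<in> N"
    using dual_lattice_zero[of "dual_lattice N"] dual_dual_lattice[OF assms(1)] by simp
  have zero_Mbar: "0 \<in> Mbar"
    unfolding assms(5) int_span_def by (auto intro!: exI[of _ "{}"])
  have Q_Mbar: "vertices Q \<subseteq> Mbar"
    unfolding assms(5,6) by (auto intro: int_span_base)
  have QP: "polar_dual Q = P"
    unfolding assms(6)
    using P(1,3) interior_subset
    by (intro polar_dual_polar_dual) (auto simp: polytope_imp_convex polytope_imp_closed)
  have zero_Q: "0 \<in> interior Q"
    unfolding assms(6) by (rule zero_in_interior_polar_dual[OF polytope_imp_bounded[OF P(1)]])
  have "reflexive_polytope N\<^sub>1 P"
    using P Q N_N1 Q_Mbar assms(8) by (auto simp: reflexive_polytope_def lattice_polytope_def N1(2) assms(6))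
  moreover have "reflexive_polytope (dual_lattice N\<^sub>1) Q"
    using P Q N_N1 Q_Mbar assms(8) zero_Q
    by (auto simp: reflexive_polytope_def lattice_polytope_def N1(2) QP simp flip: assms(10))
  moreover have "fun_space_iso (toric_quotient N P N\<^sub>1) (polytope_variety N\<^sub>1 P)"
    using P Q N1 N_N1 zero_N Q_Mbar assms(8) by (intro toric_quotient_iso) (auto simp: assms(6))
  moreover have "fun_space_iso (toric_quotient Mbar Q M\<^sub>1) (polytope_variety M\<^sub>1 Q)"
    using P Q zero_Q zero_Mbar Q_Mbar assms(7,8,10) N_N1 by (intro toric_quotient_iso) (auto simp: QP)
  ultimately have "batyrev_borisov_mirror_pair TYPE('a) (toric_quotient N P N\<^sub>1) (toric_quotient Mbar Q M\<^sub>1)"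
    unfolding batyrev_borisov_mirror_pair_def
    by (intro exI[of _ N\<^sub>1] exI[of _ P]) (simp add: N1 assms(6))
  with N_N1 N1_Nbar show ?thesis by blast
qed

end
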